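(* Let $s>0$. If $f\in L^2(\mathbb R^n)$ is non-zero and $s$-concave, then \[\frac1{\big((n+\frac2s)\mathrm{B}(\beta+1,n+\frac2s)\big)^{1/\beta}}\,\mathrm{R}_\beta f\subseteq\frac1{\big((n+\frac2s)\mathrm{B}(\alpha+1,n+\frac2s)\big)^{1/\alpha}}\,\mathrm{R}_\alpha f\] for all $-1<\alpha<\beta<\infty$.
   Context: $f:\mathbb R^n\to[0,\infty)$ is $s$-concave ($s>0$) if $f^s$ is concave on the support of $f$. $\mathrm{B}$ is the Beta function, extended to negative first argument in $(-1,0)$ by analytic continuation. Star-shaped sets are described by radial functions on $\mathbb S^{n-1}$; $\lambda K$ has radial function $\lambda\rho_K$; $K\subseteq L$ means $\rho_K\le\rho_L$. For non-negative non-zero $f\in L^2(\mathbb R^n)$: for $\alpha>0$, $\rho_{\mathrm{R}_\alpha f}(\xi)^\alpha=\frac{\alpha}{\Vert f\Vert_2^2}\int_0^\infty t^{\alpha-1}\int_{\mathbb R^n}f(x)f(x+t\xi)\,dx\,dt$; for $-1<\alpha<0$, $\rho_{\mathrm{R}_\alpha f}(\xi)^\alpha=\frac{|\alpha|}{2\Vert f\Vert_2^2}\int_0^\infty t^{\alpha-1}\int_{\mathbb R^n}|f(x+t\xi)-f(x)|^2\,dx\,dt$; and $\log\rho_{\mathrm{R}_0 f}(\xi)=-\gamma+\int_0^\infty\frac1t\big(\frac1{\Vert f\Vert_2^2}\int_{\mathbb R^n}f(x)f(x+t\xi)\,dx-e^{-t}\big)\,dt$, $\gamma$ Euler's constant.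 At index $0$ the normalizing factor is interpreted as the limit as the index tends to $0$. *)

theory Defs
  imports "HOL-Analysis.Analysis"
begin

text \<open>s-concavity (s > 0): f is non-negative and f^s is concave on the support of f.
  Note: Isabelle's concave_on includes convexity of the set, the standard convention.\<close>
definition s_concave :: "real \<Rightarrow> ('a::euclidean_space \<Rightarrow> real) \<Rightarrow> bool" where
  "s_concave s f \<longleftrightarrow> (\<forall>x. 0 \<le> f x) \<and> concave_on {x. 0 < f x} (\<lambda>x. f x powr s)"

definition L2_norm_sq :: "('a::euclidean_space \<Rightarrow> real) \<Rightarrow> real" where
  "L2_norm_sq f = (\<integral>x. (f x)\<^sup>2 \<partial>lebesgue)"

definition covar :: "('a::euclidean_space \<Rightarrow> real) \<Rightarrow> 'a \<Rightarrow> real \<Rightarrow> real" where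
  "covar f \<xi> t = (\<integral>x. f x * f (x + t *\<^sub>R \<xi>) \<partial>lebesgue)"

text \<open>Radial function of the radial mean body R_alpha f at direction xi (alpha > -1).\<close>
definition radial_mean :: "('a::euclidean_space \<Rightarrow> real) \<Rightarrow> real \<Rightarrow> 'a \<Rightarrow> real" where
  "radial_mean f \<alpha> \<xi> =
    (if 0 < \<alpha> then
       ((\<alpha> / L2_norm_sq f) *
          (LINT t:{0<..}|lborel. t powr (\<alpha> - 1) * covar f \<xi> t)) powr (1 / \<alpha>)
     else if \<alpha> < 0 then
       ((\<bar>\<alpha>\<bar> / (2 * L2_norm_sq f)) *
          (LINT t:{0<..}|lborel. t powr (\<alpha> - 1) *
              (\<integral>x. \<bar>f (x + t *\<^sub>R \<xi>) - f x\<bar>\<^sup>2 \<partial>lebesgue))) powr (1 / \<alpha>)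
     else
       exp (- euler_mascheroni +
          (LINT t:{0<..}|lborel. (1 / t) * (covar f \<xi> t / L2_norm_sq f - exp (- t)))))"

definition norm_factor :: "real \<Rightarrow> real \<Rightarrow> real" where
  "norm_factor m \<alpha> =
    (if \<alpha> = 0 then Lim (at 0) (\<lambda>a. (m * Beta (a + 1) m) powr (1 / a))
     else (m * Beta (\<alpha> + 1) m) powr (1 / \<alpha>))"

end

theory Submission
  imports Defs
begin

text \<open>
  Write \<open>g t\<close> for the covariogram of \<open>f\<close> in direction \<open>\<xi>\<close> divided by the squared norm of \<open>f\<close>, and
  \<open>m = n + 2 / s\<close>. The function \<open>f x * f (x + t \<xi>)\<close> is \<open>s / 2\<close>-concave in \<open>(x, t)\<close>, hence by the
  Borell-Brascamp-Lieb inequality \<open>g\<close> to the power \<open>1 / m\<close> is concave; it equals 1 at 0. For the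
  extremal functions \<open>(1 - t / L)\<^sub>+\<close> to the power \<open>m\<close>, the radius \<open>\<rho>\<^sub>\<alpha>\<close> is exactly \<open>L\<close> times the
  normalizing factor. Choose \<open>L\<close> such that \<open>\<rho>\<^sub>\<alpha>\<close> of \<open>g\<close> agrees with that of the extremal function
  \<open>h\<close>. For all three ranges of the index, comparing \<open>\<rho>\<^sub>\<alpha>\<close> of \<open>g\<close> and \<open>h\<close> means finding the sign of the
  integral of \<open>t powr (\<alpha> - 1) * (g t - h t)\<close>. By concavity \<open>g - h\<close> changes sign only once, from plus
  to minus; since its integral against \<open>t powr (\<alpha> - 1)\<close> vanishes, the one against \<open>t powr (\<beta> - 1)\<close>
  is nonpositive.
\<close>

section \<open>The Borell-Brascamp-Lieb inequality\<close>

text \<open>In \<open>power_mean\<close> the parameter \<open>k\<close> is the reciprocal of the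
  exponent of concavity, because reciprocals are what add up: Cauchy-Schwarz turns two factors with
  reciprocal \<open>1 / s\<close> into a product with \<open>2 / s\<close>, and integrating out one
  real variable raises \<open>k\<close> by 1. The n variables of the covariogram integral therefore
  lead to \<open>m\<close>. The three formulas for the radius compare \<open>g\<close> with
  different reference functions (0, 1 and exp(-t)) under the same weight. The reference drops out of
  the difference of two profiles, so one criterion serves all indices and a pair \<alpha> < 0 <
  \<beta> is no special case. At index 0 the radius of the extremal function is not itself a Beta
  integral; it is obtained by letting positive indices tend to 0. A measure-theoretic obstacle
  remains: f is only Lebesgue measurable and concavity does not control it at the boundary of its
  support, while the layer-cake and product-measure arguments work with Borel functions. A
  representative that vanishes outside the interior of the support resolves this.\<close>

definition power_mean :: "real \<Rightarrow> real \<Rightarrow> real \<Rightarrow> real \<Rightarrow> real" where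
  "power_mean k l a b = ((1 - l) * a powr (1 / k) + l * b powr (1 / k)) powr k"

lemma power_mean_pos:
  assumes "0 < l" "l < 1" "0 < a" "0 < b"
  shows "0 < power_mean k l a b"
proof -
  have "0 < (1 - l) * a powr (1 / k) + l * b powr (1 / k)"
    using assms by (intro add_pos_pos mult_pos_pos) auto
  then show ?thesis by (simp add: power_mean_def)
qed

lemma power_mean_mono:
  assumes "0 < k" "0 < l" "l < 1" "0 \<le> a" "0 \<le> b" "a \<le> a'" "b \<le> b'"
  shows "power_mean k l a b \<le> power_mean k l a' b'"
  unfolding power_mean_def using assms
  by (intro powr_mono2 add_mono mult_left_mono add_nonneg_nonneg mult_nonneg_nonneg) auto

lemma power_mean_scale:
  assumes "0 < k" "0 < l" "l < 1" "0 \<le> a" "0 \<le> b" "0 \<le> c"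
  shows "power_mean k l (c * a) (c * b) = c * power_mean k l a b"
proof -
  have "power_mean k l (c * a) (c * b) =
      (c powr (1 / k) * ((1 - l) * a powr (1 / k) + l * b powr (1 / k))) powr k"
    unfolding power_mean_def using assms by (simp add: powr_mult algebra_simps)
  also have "\<dots> = (c powr (1 / k)) powr k * power_mean k l a b"
    unfolding power_mean_def using assms by (subst powr_mult) auto
  also have "(c powr (1 / k)) powr k = c"
    using assms by (simp add: powr_powr)
  finally show ?thesis .
qed

text \<open>Jensen's inequality for the convex power \<open>k + 1\<close> at the points
  \<open>u / X\<close> and \<open>v / Y\<close>. The weights \<open>1 - w\<close> and
  \<open>w\<close> are proportional to \<open>(1 - l) * X\<close> and \<open>l * Y\<close>, so that
  they cancel the denominators. In the one-dimensional theorem \<open>A\<close>, \<open>B\<close>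
  will be suprema and \<open>a\<close>, \<open>b\<close> lower bounds for integrals; this inequality
  is where \<open>k\<close> becomes \<open>k + 1\<close>.\<close>

lemma power_mean_Holder:
  assumes k: "0 < k" and l: "0 < l" "l < 1" and pos: "0 < a" "0 < b" "0 < A" "0 < B"
  shows "power_mean (k + 1) l a b \<le> power_mean k l A B * ((1 - l) * (a / A) + l * (b / B))"
proof -
  define X where "X = A powr (1 / k)"
  define Y where "Y = B powr (1 / k)"
  define u where "u = a powr (1 / (k + 1))"
  define v where "v = b powr (1 / (k + 1))"
  define S where "S = (1 - l) * X + l * Y"
  define w where "w = l * Y / S"
  have p: "0 < X" "0 < Y" "0 < u" "0 < v" using pos by (auto simp: X_def Y_def u_def v_def)
  have S: "0 < S" unfolding S_def using l p by (intro add_pos_pos mult_pos_pos) auto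
  have w1: "1 - w = (1 - l) * X / S" using S by (simp add: w_def S_def field_simps)
  have w0: "0 \<le> w" using l p S by (simp add: w_def)
  have w2: "w \<le> 1" 
    using l p S w1 by (smt (verit) divide_nonneg_pos mult_nonneg_nonneg)
  have e: "X powr k = A" "Y powr k = B" "u powr (k + 1) = a" "v powr (k + 1) = b"
    using k pos by (auto simp: X_def Y_def u_def v_def powr_powr)
  have conv: "convex_on {0<..} (\<lambda>x::real. x powr (k + 1))"
    using k by (intro powr_convex) auto
  have "((1 - w) *\<^sub>R (u / X) + w *\<^sub>R (v / Y)) powr (k + 1)
      \<le> (1 - w) * (u / X) powr (k + 1) + w * (v / Y) powr (k + 1)"
    by (rule convex_onD[OF conv w0 w2]) (use p in auto)
  also have "(1 - w) *\<^sub>R (u / X) + w *\<^sub>R (v / Y) = ((1 - l) * u + l * v) / S"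
    unfolding w1 unfolding w_def using p S by (simp add: add_divide_distrib)
  also have "(u / X) powr (k + 1) = a / (A * X)"
    using p e(1,3) by (simp add: powr_divide) (simp add: powr_add)
  also have "(v / Y) powr (k + 1) = b / (B * Y)"
    using p e(2,4) by (simp add: powr_divide) (simp add: powr_add)
  also have "(1 - w) * (a / (A * X)) + w * (b / (B * Y)) = ((1 - l) * (a / A) + l * (b / B)) / S"
    unfolding w1 unfolding w_def using p S pos by (simp add: add_divide_distrib mult.commute)
  also have "(((1 - l) * u + l * v) / S) powr (k + 1) = power_mean (k + 1) l a b / (S powr k * S)"
    using p S l by (simp add: powr_divide power_mean_def u_def v_def powr_add)
  finally have "power_mean (k + 1) l a b / (S powr k * S) \<le> ((1 - l) * (a / A) + l * (b / B)) / S" .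
  then have "power_mean (k + 1) l a b \<le> S powr k * ((1 - l) * (a / A) + l * (b / B))"
    using S by (simp add: field_simps)
  then show ?thesis by (simp add: power_mean_def S_def X_def Y_def)
qed

section \<open>The Brunn-Minkowski inequality on the real line\<close>

lemma lborel_compact_inner_approx:
  fixes B :: "'a::euclidean_space set"
  assumes B: "B \<in> sets borel" and c: "c < emeasure lborel B"
  obtains K where "compact K" "K \<subseteq> B" "c < emeasure lborel K"
proof -
  let ?C = "\<lambda>n::nat. cball (0::'a) (real n)"
  have un: "(\<Union>n. B \<inter> ?C n) = B"
    using real_arch_simple by auto
  have "(SUP n. emeasure lborel (B \<inter> ?C n)) = emeasure lborel (\<Union>n. B \<inter> ?C n)"
    by (rule SUP_emeasure_incseq) (use B in \<open>auto simp: incseq_def\<close>)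
  with c un have "c < (SUP n. emeasure lborel (B \<inter> ?C n))" by simp
  then obtain n where n: "c < emeasure lborel (B \<inter> ?C n)"
    by (auto simp: less_SUP_iff)
  \<comment> \<open>Restriction to the ball makes the measure finite, as
    \<open>inner_regular\<close> demands.\<close>
  let ?M = "density lborel (indicator (?C n)) :: 'a measure"
  have M: "emeasure ?M A = emeasure lborel (A \<inter> ?C n)" if "A \<in> sets borel" for A
    using that by (subst emeasure_density) (auto simp: indicator_inter_arith[symmetric] Int_commute mult.commute nn_integral_indicator intro!: borel_measurable_indicator)
  have "emeasure ?M B = (SUP K \<in> {K. K \<subseteq> B \<and> compact K}. emeasure ?M K)"
  proof (rule inner_regular)
    have "emeasure ?M (space ?M) = emeasure lborel (?C n)" using M[of UNIV] by simp
    then show "emeasure ?M (space ?M) \<noteq> \<infinity>"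
      using emeasure_lborel_cball_finite[of "0::'a" "real n"] by auto
  qed (use B in auto)
  with n M[OF B] have "c < (SUP K \<in> {K. K \<subseteq> B \<and> compact K}. emeasure ?M K)" by simp
  then obtain K where K: "K \<subseteq> B" "compact K" "c < emeasure ?M K"
    by (auto simp: less_SUP_iff)
  have "c < emeasure lborel (K \<inter> ?C n)"
    using K M[of K] by (simp add: borel_compact)
  then show thesis
    using K that[of "K \<inter> ?C n"] by (auto simp: compact_Int_closed)
qed

lemma emeasure_lborel_scale:
  fixes S :: "real set"
  assumes "S \<in> sets borel" "0 < c"
  shows "(\<lambda>x. c * x) ` S \<in> sets borel"
    and "emeasure lborel ((\<lambda>x. c * x) ` S) = ennreal c * emeasure lborel S"
proof -
  have m: "(\<lambda>x. x / c) \<in> borel_measurable borel" by measurable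
  have im: "(\<lambda>x. c * x) ` S = (\<lambda>x. x / c) -` S"
  proof (intro set_eqI iffI)
    fix x assume "x \<in> (\<lambda>x. x / c) -` S"
    then have "x / c \<in> S" by simp
    then show "x \<in> (\<lambda>x. c * x) ` S" using assms by (intro image_eqI[of _ _ "x / c"]) auto
  qed (use assms in auto)
  show ms: "(\<lambda>x. c * x) ` S \<in> sets borel"
    unfolding im using measurable_sets[OF m assms(1)] by simp
  have "emeasure lborel ((\<lambda>x. c * x) ` S) = (\<integral>\<^sup>+x. indicator ((\<lambda>x. c * x) ` S) x \<partial>lborel)"
    using ms by simp
  also have "\<dots> = ennreal \<bar>c\<bar> * (\<integral>\<^sup>+x. indicator ((\<lambda>x. c * x) ` S) (0 + c * x) \<partial>lborel)"
    by (rule nn_integral_real_affine) (use ms assms in auto)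
  also have "(\<integral>\<^sup>+x. indicator ((\<lambda>x. c * x) ` S) (0 + c * x) \<partial>lborel) = (\<integral>\<^sup>+x. indicator S x \<partial>lborel)"
    by (intro nn_integral_cong) (use assms in \<open>auto simp: indicator_def\<close>)
  finally show "emeasure lborel ((\<lambda>x. c * x) ` S) = ennreal c * emeasure lborel S"
    using assms by simp
qed

lemma emeasure_lborel_plus:
  fixes S :: "'a::euclidean_space set"
  assumes "S \<in> sets borel"
  shows "emeasure lborel ((\<lambda>x. c + x) ` S) = emeasure lborel S"
proof -
  have im: "(\<lambda>x. c + x) ` S = (\<lambda>x. - c + x) -` S"
    by (auto simp: image_iff intro!: bexI[where x = "_ - c"])
  have "emeasure lborel S = emeasure (distr lborel borel ((+) (- c))) S"
    by (simp add: lborel_distr_plus)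
  also have "\<dots> = emeasure lborel ((\<lambda>x. - c + x) -` S)"
    using assms by (subst emeasure_distr) auto
  finally show ?thesis by (simp add: im)
qed

text \<open>For compact sets, shift one by the minimum of the other and the other by the maximum of
  the first: both translates lie in \<open>U\<close> and meet in one point, so their lengths add.
  General sets are exhausted by compact subsets. Allowing any Borel \<open>U\<close> that contains
  the sums avoids asking whether the sumset is measurable.\<close>

lemma Brunn_Minkowski_real:
  fixes S T U :: "real set"
  assumes S: "S \<in> sets borel" "S \<noteq> {}" and T: "T \<in> sets borel" "T \<noteq> {}" and U: "U \<in> sets borel"
    and sum: "\<And>x y. x \<in> S \<Longrightarrow> y \<in> T \<Longrightarrow> x + y \<in> U"
  shows "emeasure lborel S + emeasure lborel T \<le> emeasure lborel U"
proof -
  have cpt: "emeasure lborel K + emeasure lborel L \<le> emeasure lborel U"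
    if K: "compact K" "K \<subseteq> S" "K \<noteq> {}" and L: "compact L" "L \<subseteq> T" "L \<noteq> {}" for K L
  proof -
    obtain x where x: "x \<in> K" "\<And>z. z \<in> K \<Longrightarrow> z \<le> x"
      using compact_attains_sup[OF K(1,3)] by auto
    obtain y where y: "y \<in> L" "\<And>z. z \<in> L \<Longrightarrow> y \<le> z"
      using compact_attains_inf[OF L(1,3)] by auto
    have c: "compact ((\<lambda>z. y + z) ` K)" "compact ((\<lambda>z. x + z) ` L)"
      using K L by (auto intro!: compact_translation)
    have "emeasure lborel K + emeasure lborel L
        = emeasure lborel ((\<lambda>z. y + z) ` K) + emeasure lborel ((\<lambda>z. x + z) ` L)"
      using K L by (simp add: emeasure_lborel_plus borel_compact)
    \<comment> \<open>The first translate lies to the left of \<open>x + y\<close> and the second to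
      the right, so deleting this point makes them disjoint.\<close>
    also have "emeasure lborel ((\<lambda>z. x + z) ` L) = emeasure lborel ((\<lambda>z. x + z) ` L - {x + y})"
      using c by (intro emeasure_Diff_null_set[symmetric]) (auto simp: borel_compact finite_imp_null_set_lborel)
    also have "emeasure lborel ((\<lambda>z. y + z) ` K) + \<dots>
        = emeasure lborel ((\<lambda>z. y + z) ` K \<union> ((\<lambda>z. x + z) ` L - {x + y}))"
      using c x y by (intro plus_emeasure) (auto simp: borel_compact, smt (verit))
    also have "\<dots> \<le> emeasure lborel U"
      using sum K L x y U by (intro emeasure_mono) (auto simp: add.commute[of y])
    finally show ?thesis .
  qed
  obtain x0 y0 where xy: "x0 \<in> S" "y0 \<in> T" using S T by auto
  have step: "c + d \<le> emeasure lborel U"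
    if cd: "c < emeasure lborel S" "d < emeasure lborel T" for c d
  proof -
    obtain K where K: "compact K" "K \<subseteq> S" "c < emeasure lborel K"
      using lborel_compact_inner_approx[OF S(1) cd(1)] by blast
    obtain L where L: "compact L" "L \<subseteq> T" "d < emeasure lborel L"
      using lborel_compact_inner_approx[OF T(1) cd(2)] by blast
    have "K \<noteq> {}" "L \<noteq> {}" using K L by auto
    then have "emeasure lborel K + emeasure lborel L \<le> emeasure lborel U"
      using cpt K L by auto
    with K L show ?thesis by (meson add_mono less_imp_le order_trans)
  qed
  \<comment> \<open>\<open>step\<close> is vacuous if one of the sets is null, as nothing lies
    strictly below 0. There a single point takes the place of the compact subset.\<close>
  have half: "c \<le> emeasure lborel U" if c: "c < emeasure lborel T" for c
  proof -
    obtain L where L: "compact L" "L \<subseteq> T" "c < emeasure lborel L"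
      using lborel_compact_inner_approx[OF T(1) c] by blast
    then have "L \<noteq> {}" by auto
    with cpt[of "{x0}" L] L xy show ?thesis by auto
  qed
  have half': "c \<le> emeasure lborel U" if c: "c < emeasure lborel S" for c
  proof -
    obtain L where L: "compact L" "L \<subseteq> S" "c < emeasure lborel L"
      using lborel_compact_inner_approx[OF S(1) c] by blast
    then have "L \<noteq> {}" by auto
    with cpt[of L "{y0}"] L xy show ?thesis by auto
  qed
  show ?thesis
  proof (cases "emeasure lborel S = 0 \<or> emeasure lborel T = 0")
    case True
    with half half' show ?thesis by (auto intro: dense_le)
  next
    case False
    then have ne: "{..<emeasure lborel S} \<noteq> {}" "{..<emeasure lborel T} \<noteq> {}"
      by (metis lessThan_iff empty_iff zero_less_iff_neq_zero)+
    \<comment> \<open>Each measure is recovered as the supremum of the values strictly below it,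
      also when it is infinite.\<close>
    have sup: "(SUP d\<in>{..<x}. d) = x" for x :: ennreal
    proof (rule antisym)
      show "x \<le> (SUP d\<in>{..<x}. d)" by (rule dense_le) (auto intro: SUP_upper)
    qed (auto intro: SUP_least)
    have "c + emeasure lborel T \<le> emeasure lborel U" if c: "c < emeasure lborel S" for c
    proof -
      have "c + (SUP d\<in>{..<emeasure lborel T}. d) = (SUP d\<in>{..<emeasure lborel T}. c + d)"
        using ne(2) by (rule ennreal_SUP_add_right)
      also have "\<dots> \<le> emeasure lborel U" using step c by (auto intro: SUP_least)
      finally show ?thesis by (simp only: sup)
    qed
    moreover have "(SUP c\<in>{..<emeasure lborel S}. c) + emeasure lborel T
        = (SUP c\<in>{..<emeasure lborel S}. c + emeasure lborel T)"
      using ne(1) by (intro ennreal_SUP_add_left[symmetric]) auto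
    ultimately show ?thesis unfolding sup by (auto intro: SUP_least)
  qed
qed

section \<open>Layer-cake integration and truncation\<close>

lemma nn_integral_layer_cake:
  fixes h :: "'a::euclidean_space \<Rightarrow> ennreal"
  assumes [measurable]: "h \<in> borel_measurable borel"
  shows "(\<integral>\<^sup>+x. h x \<partial>lborel) = (\<integral>\<^sup>+u. indicator {0<..} u * emeasure lborel {x. ennreal u < h x} \<partial>lborel)"
proof -
  have I: "emeasure lborel {u. 0 < u \<and> ennreal u < y} = y" for y
  proof (cases y)
    case (real r)
    then have "{u. 0 < u \<and> ennreal u < y} = {0<..<r}" by (auto simp: ennreal_less_iff)
    with real show ?thesis by simp
  next
    case top
    have "emeasure lborel {0<..<real n} \<le> emeasure lborel {0::real<..}" for n
      by (intro emeasure_mono) auto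
    then have "of_nat n \<le> emeasure lborel {0::real<..}" for n
      by (simp add: ennreal_of_nat_eq_real_of_nat)
    then have "emeasure lborel {0::real<..} = top"
      by (metis ennreal_SUP_of_nat_eq_top SUP_least top.extremum_uniqueI)
    moreover have "{u. 0 < u \<and> ennreal u < y} = {0<..}" using top by auto
    ultimately show ?thesis using top by simp
  qed
  have "(\<integral>\<^sup>+x. h x \<partial>lborel) = (\<integral>\<^sup>+x. (\<integral>\<^sup>+u. indicator {u. 0 < u \<and> ennreal u < h x} u \<partial>lborel) \<partial>lborel)"
    by (intro nn_integral_cong) (simp add: I)
  also have "\<dots> = (\<integral>\<^sup>+u. (\<integral>\<^sup>+x. indicator {u. 0 < u \<and> ennreal u < h x} u \<partial>lborel) \<partial>lborel)"
    by (rule lborel_pair.Fubini') (simp add: indicator_def split_beta)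
  also have "\<dots> = (\<integral>\<^sup>+u. indicator {0<..} u * emeasure lborel {x. ennreal u < h x} \<partial>lborel)"
  proof (intro nn_integral_cong)
    fix u :: real
    have "(\<integral>\<^sup>+x. indicator {u. 0 < u \<and> ennreal u < h x} u \<partial>lborel)
        = (\<integral>\<^sup>+x. indicator {0<..} u * indicator {x. ennreal u < h x} x \<partial>lborel)"
      by (intro nn_integral_cong) (auto simp: indicator_def)
    also have "\<dots> = indicator {0<..} u * emeasure lborel {x. ennreal u < h x}"
      by (subst nn_integral_cmult) auto
    finally show "(\<integral>\<^sup>+x. indicator {u. 0 < u \<and> ennreal u < h x} u \<partial>lborel) = \<dots>" .
  qed
  finally show ?thesis .
qed

text \<open>With \<open>c\<close> the supremum of the function, the relevant levels \<open>u\<close>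
  run through (0, 1). Functions with different suprema can then be compared level by level.\<close>

lemma nn_integral_normalized_layer_cake:
  fixes h :: "real \<Rightarrow> ennreal"
  assumes [measurable]: "h \<in> borel_measurable borel" and c: "0 < c"
  shows "(\<integral>\<^sup>+x. h x \<partial>lborel) =
    ennreal c * (\<integral>\<^sup>+u. indicator {0<..} u * emeasure lborel {x. ennreal (c * u) < h x} \<partial>lborel)"
proof -
  have "(\<integral>\<^sup>+x. h x \<partial>lborel) = (\<integral>\<^sup>+u. indicator {0<..} u * emeasure lborel {x. ennreal u < h x} \<partial>lborel)"
    by (rule nn_integral_layer_cake) measurable
  also have "\<dots> = ennreal \<bar>c\<bar> * (\<integral>\<^sup>+u. indicator {0<..} (0 + c * u) * emeasure lborel {x. ennreal (0 + c * u) < h x} \<partial>lborel)"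
  proof (rule nn_integral_real_affine)
    have "(\<lambda>u. emeasure lborel {x \<in> space lborel. ennreal u < h x}) \<in> borel_measurable lborel"
      by measurable
    then show "(\<lambda>u. indicator {0<..} u * emeasure lborel {x. ennreal u < h x}) \<in> borel_measurable borel"
      by simp
  qed (use c in auto)
  also have "\<dots> = ennreal c * (\<integral>\<^sup>+u. indicator {0<..} u * emeasure lborel {x. ennreal (c * u) < h x} \<partial>lborel)"
    using c by (intro arg_cong2[where f = "(*)"] nn_integral_cong) (auto simp: indicator_def zero_less_mult_iff)
  finally show ?thesis .
qed

text \<open>Supplies functions with finite suprema, by which heights can be normalized; monotone
  convergence keeps the integral above the given bound.\<close>

lemma nn_integral_truncate_approx:
  fixes h :: "'a \<Rightarrow> ennreal"
  assumes [measurable]: "h \<in> borel_measurable M" and a: "a < (\<integral>\<^sup>+x. h x \<partial>M)"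
  obtains K :: nat where "a < (\<integral>\<^sup>+x. min (h x) (of_nat K) \<partial>M)"
proof -
  have sup: "(SUP n. min y (of_nat n)) = y" for y :: ennreal
  proof -
    have "(SUP n. min y (of_nat n)) = min y (SUP n. of_nat n)"
      by (simp add: inf_min[symmetric] inf_SUP)
    then show ?thesis by (simp add: ennreal_SUP_of_nat_eq_top min_def)
  qed
  have "(\<integral>\<^sup>+x. h x \<partial>M) = (\<integral>\<^sup>+x. (SUP n. min (h x) (of_nat n)) \<partial>M)"
    by (simp add: sup)
  also have "\<dots> = (SUP n. \<integral>\<^sup>+x. min (h x) (of_nat n) \<partial>M)"
    by (rule nn_integral_monotone_convergence_SUP)
       (auto simp: incseq_def le_fun_def min_le_iff_disj intro!: min.mono)
  finally show thesis using a that by (auto simp: less_SUP_iff)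
qed

text \<open>The hypothesis only speaks of real numbers strictly below the values of the functions. Infinite
  values are then harmless, and the conclusion has the shape of the hypothesis with \<^term>\<open>k + 1\<close> for
  \<^term>\<open>k\<close>, so that the one-dimensional result can be iterated over the coordinates.\<close>

lemma Borell_Brascamp_Lieb_bounded:
  fixes g0 g1 h :: "real \<Rightarrow> ennreal"
  assumes k: "0 < k" and l: "0 < l" "l < 1"
    and [measurable]: "g0 \<in> borel_measurable borel" "g1 \<in> borel_measurable borel" "h \<in> borel_measurable borel"
    and H: "\<And>x y a b. 0 < a \<Longrightarrow> 0 < b \<Longrightarrow> ennreal a < g0 x \<Longrightarrow> ennreal b < g1 y \<Longrightarrow>
        ennreal (power_mean k l a b) \<le> h ((1 - l) * x + l * y)"
    and A: "(SUP x. g0 x) = ennreal A" "0 < A" and B: "(SUP x. g1 x) = ennreal B" "0 < B"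
    and a: "0 < a" "ennreal a \<le> (\<integral>\<^sup>+x. g0 x \<partial>lborel)" and b: "0 < b" "ennreal b \<le> (\<integral>\<^sup>+x. g1 x \<partial>lborel)"
  shows "ennreal (power_mean (k + 1) l a b) \<le> (\<integral>\<^sup>+x. h x \<partial>lborel)"
proof -
  define M where "M = power_mean k l A B"
  have M: "0 < M" unfolding M_def using power_mean_pos l A B by blast
  \<comment> \<open>The layer-cake integral over relative heights \<open>u\<close>, as fractions of
    \<open>c\<close>. If \<open>c\<close> is the supremum, nothing is lost by stopping at 1.\<close>
  define I where "I = (\<lambda>c (g :: real \<Rightarrow> ennreal). \<integral>\<^sup>+u. indicator {0<..<1} u * emeasure lborel {x. ennreal (c * u) < g x} \<partial>lborel)"
  have meas: "(\<lambda>u. emeasure lborel {x. ennreal (c * u) < g x}) \<in> borel_measurable lborel"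
    if [measurable]: "g \<in> borel_measurable borel" for g and c :: real
  proof -
    have "(\<lambda>u. emeasure lborel {x \<in> space lborel. ennreal (c * u) < g x}) \<in> borel_measurable lborel"
      by measurable
    then show ?thesis by simp
  qed
  note [measurable] = meas
  have cap: "ennreal (a / A) \<le> I A g"
    if g[measurable]: "g \<in> borel_measurable borel" and s: "(SUP x. g x) = ennreal A" "0 < A"
      and a: "0 < a" "ennreal a \<le> (\<integral>\<^sup>+x. g x \<partial>lborel)" for g a A
  proof -
    have le: "g x \<le> ennreal A" for x using s by (metis SUP_upper UNIV_I)
    have z: "{x. ennreal (A * u) < g x} = {}" if "1 \<le> u" for u
    proof -
      have "ennreal A \<le> ennreal (A * u)" using that s by (intro ennreal_leI) auto
      then show ?thesis using le by (auto simp: not_less intro: order_trans)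
    qed
    have "ennreal A * ennreal (a / A) = ennreal a"
      using s a by (simp add: ennreal_mult[symmetric])
    also have "\<dots> \<le> (\<integral>\<^sup>+x. g x \<partial>lborel)" by fact
    also have "\<dots> = ennreal A * (\<integral>\<^sup>+u. indicator {0<..} u * emeasure lborel {x. ennreal (A * u) < g x} \<partial>lborel)"
      by (rule nn_integral_normalized_layer_cake) (use s in auto)
    also have "(\<integral>\<^sup>+u. indicator {0<..} u * emeasure lborel {x. ennreal (A * u) < g x} \<partial>lborel) = I A g"
      unfolding I_def by (intro nn_integral_cong) (auto simp: indicator_def z)
    finally show ?thesis using s by (subst (asm) ennreal_mult_le_mult_iff) auto
  qed
  \<comment> \<open>Brunn-Minkowski fails for an empty set. Measuring heights relative to the
    suprema makes both level sets nonempty for every \<open>u < 1\<close>; this is the reason for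
    the normalization.\<close>
  have sets: "emeasure lborel {x. ennreal (A * u) < g0 x} * ennreal (1 - l) + ennreal l * emeasure lborel {x. ennreal (B * u) < g1 x}
      \<le> emeasure lborel {x. ennreal (M * u) < h x}" if u: "0 < u" "u < 1" for u
  proof -
    let ?S = "{x. ennreal (A * u) < g0 x}" and ?T = "{x. ennreal (B * u) < g1 x}"
    have Au: "ennreal (A * u) < (SUP x. g0 x)" "ennreal (B * u) < (SUP x. g1 x)"
      using A B u by (auto simp: ennreal_less_iff)
    then have ne: "?S \<noteq> {}" "?T \<noteq> {}" by (auto simp: less_SUP_iff)
    have ms: "?S \<in> sets borel" "?T \<in> sets borel" by measurable
    have sc: "emeasure lborel ((\<lambda>x. (1 - l) * x) ` ?S) = ennreal (1 - l) * emeasure lborel ?S"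
      "emeasure lborel ((\<lambda>x. l * x) ` ?T) = ennreal l * emeasure lborel ?T"
      using l ms by (auto intro!: emeasure_lborel_scale)
    have "emeasure lborel ((\<lambda>x. (1 - l) * x) ` ?S) + emeasure lborel ((\<lambda>x. l * x) ` ?T)
        \<le> emeasure lborel {x. ennreal (M * u) < h x}"
    proof (rule Brunn_Minkowski_real)
      show "(\<lambda>x. (1 - l) * x) ` ?S \<in> sets borel" "(\<lambda>x. l * x) ` ?T \<in> sets borel"
        using l ms by (auto intro!: emeasure_lborel_scale)
      fix x' y' assume "x' \<in> (\<lambda>x. (1 - l) * x) ` ?S" "y' \<in> (\<lambda>x. l * x) ` ?T"
      then obtain x y where xy: "x' = (1 - l) * x" "y' = l * y"
        "ennreal (A * u) < g0 x" "ennreal (B * u) < g1 y" by auto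
      have "g0 x \<le> ennreal A" "g1 y \<le> ennreal B"
        using A B by (metis SUP_upper UNIV_I)+
      then obtain r q where rq: "g0 x = ennreal r" "0 \<le> r" "g1 y = ennreal q" "0 \<le> q"
        by (metis ennreal_cases neq_top_trans ennreal_neq_top)
      have lt: "u < min (r / A) (q / B)"
        using xy rq A B u by (auto simp: ennreal_less_iff field_simps)
      \<comment> \<open>\<open>H\<close> gives only a weak lower bound for \<open>h\<close>, while
        the level sets are strict. A height \<open>v\<close> slightly above \<open>u\<close> makes
        up for it.\<close>
      then obtain v where v: "u < v" "v < r / A" "v < q / B" by (metis dense min_less_iff_conj)
      have "A * v < r" "B * v < q" using v A B by (auto simp: field_simps)
      moreover have v0: "0 < v" using u v by simp
      ultimately have "ennreal (power_mean k l (v * A) (v * B)) \<le> h ((1 - l) * x + l * y)"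
        using rq A B by (intro H) (auto simp: ennreal_less_iff mult.commute)
      also have "power_mean k l (v * A) (v * B) = v * M"
        unfolding M_def using A B v0 k l by (intro power_mean_scale) auto
      finally have "ennreal (v * M) \<le> h ((1 - l) * x + l * y)" .
      moreover have "ennreal (M * u) < ennreal (v * M)"
        using v M u by (auto simp: ennreal_less_iff)
      ultimately show "x' + y' \<in> {x. ennreal (M * u) < h x}" using xy by auto
    qed (use ne in auto)
    then show ?thesis unfolding sc by (simp only: mult.commute[of "ennreal (1 - l)"])
  qed
  \<comment> \<open>\<open>power_mean_Holder\<close> comes first: it leaves an arithmetic mean of
    normalized integrals, which is linear in the measures of the level sets.\<close>
  have "ennreal (power_mean (k + 1) l a b) \<le> ennreal (M * ((1 - l) * (a / A) + l * (b / B)))"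
    unfolding M_def using power_mean_Holder[OF k l a(1) b(1) A(2) B(2)] by (rule ennreal_leI)
  also have "\<dots> = ennreal M * (ennreal (a / A) * ennreal (1 - l) + ennreal l * ennreal (b / B))"
    using M l a A b B by (simp add: ennreal_mult'[symmetric] ennreal_plus[symmetric] mult.commute del: ennreal_plus)
  also have "\<dots> \<le> ennreal M * (I A g0 * ennreal (1 - l) + ennreal l * I B g1)"
    using cap[of g0 A a] cap[of g1 B b] A B a b
    by (intro mult_left_mono add_mono mult_right_mono) auto
  also have "I A g0 * ennreal (1 - l) + ennreal l * I B g1 =
      (\<integral>\<^sup>+u. indicator {0<..<1} u * (emeasure lborel {x. ennreal (A * u) < g0 x} * ennreal (1 - l) + ennreal l * emeasure lborel {x. ennreal (B * u) < g1 x}) \<partial>lborel)"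
    unfolding I_def
    by (subst nn_integral_multc[symmetric], measurable, subst nn_integral_cmult[symmetric], measurable,
        subst nn_integral_add[symmetric], measurable) (auto intro!: nn_integral_cong simp: algebra_simps)
  also have "\<dots> \<le> (\<integral>\<^sup>+u. indicator {0<..} u * emeasure lborel {x. ennreal (M * u) < h x} \<partial>lborel)"
    using sets by (intro nn_integral_mono) (auto simp: indicator_def)
  also have "ennreal M * \<dots> = (\<integral>\<^sup>+x. h x \<partial>lborel)"
    by (rule nn_integral_normalized_layer_cake[symmetric]) (use M in auto)
  finally show ?thesis by (simp add: mult_left_mono)
qed

text \<open>Truncation at large integers keeps the integrals above \<open>a\<close> and
  \<open>b\<close> and makes the suprema finite. \<open>H\<close> is inherited, because a number
  below the truncated function is below the function.\<close>

lemma Borell_Brascamp_Lieb_real: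
  fixes h0 h1 h :: "real \<Rightarrow> ennreal"
  assumes k: "0 < k" and l: "0 < l" "l < 1"
    and [measurable]: "h0 \<in> borel_measurable borel" "h1 \<in> borel_measurable borel" "h \<in> borel_measurable borel"
    and H: "\<And>x y a b. 0 < a \<Longrightarrow> 0 < b \<Longrightarrow> ennreal a < h0 x \<Longrightarrow> ennreal b < h1 y \<Longrightarrow>
        ennreal (power_mean k l a b) \<le> h ((1 - l) * x + l * y)"
    and a: "0 < a" "ennreal a < (\<integral>\<^sup>+x. h0 x \<partial>lborel)" and b: "0 < b" "ennreal b < (\<integral>\<^sup>+x. h1 x \<partial>lborel)"
  shows "ennreal (power_mean (k + 1) l a b) \<le> (\<integral>\<^sup>+x. h x \<partial>lborel)"
proof -
  have sup: "\<exists>A>0. (SUP x. min (g x) (of_nat K)) = ennreal A"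
    if "0 < (\<integral>\<^sup>+x. min (g x) (of_nat K) \<partial>lborel)" for g :: "real \<Rightarrow> ennreal" and K
  proof -
    let ?s = "SUP x. min (g x) (of_nat K)"
    have "?s \<le> of_nat K" by (intro SUP_least) auto
    then have "?s \<noteq> top" using ennreal_of_nat_neq_top[of K] by (metis neq_top_trans)
    then obtain A where A: "?s = ennreal A" "0 \<le> A" by (cases ?s) auto
    have "A \<noteq> 0"
    proof
      assume "A = 0"
      with A have "min (g x) (of_nat K) = 0" for x
        by (metis SUP_upper UNIV_I ennreal_0 le_zero_eq)
      with that show False by simp
    qed
    with A have "0 < A" by simp
    with A(1) show ?thesis by blast
  qed
  have m: "h0 \<in> borel_measurable lborel" "h1 \<in> borel_measurable lborel" by measurable
  obtain K where K: "ennreal a < (\<integral>\<^sup>+x. min (h0 x) (of_nat K) \<partial>lborel)"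
    using nn_integral_truncate_approx[OF m(1) a(2)] by blast
  obtain L where L: "ennreal b < (\<integral>\<^sup>+x. min (h1 x) (of_nat L) \<partial>lborel)"
    using nn_integral_truncate_approx[OF m(2) b(2)] by blast
  have "0 < (\<integral>\<^sup>+x. min (h0 x) (of_nat K) \<partial>lborel)" "0 < (\<integral>\<^sup>+x. min (h1 x) (of_nat L) \<partial>lborel)"
    using K L by (auto intro: le_less_trans[OF zero_le])
  with sup obtain A B where AB: "0 < A" "(SUP x. min (h0 x) (of_nat K)) = ennreal A"
    "0 < B" "(SUP x. min (h1 x) (of_nat L)) = ennreal B" by metis
  show ?thesis
    by (rule Borell_Brascamp_Lieb_bounded[where ?g0.0 = "\<lambda>x. min (h0 x) (of_nat K)" and ?g1.0 = "\<lambda>x. min (h1 x) (of_nat L)"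
          and A = A and B = B, OF k l])
       (use AB K L a b H in auto)
qed

text \<open>Induction on the coordinates by Fubini. Integrating out the new coordinate with the
  one-dimensional theorem gives functions of the remaining ones that satisfy the hypothesis with
  \<open>k + 1\<close>, and the induction hypothesis takes over from there. Over no coordinates the
  product is a one-point space, where the hypothesis is already the claim.\<close>

lemma Borell_Brascamp_Lieb_PiM:
  fixes h0 h1 h :: "('i \<Rightarrow> real) \<Rightarrow> ennreal"
  assumes "finite I" and "0 < k" and l: "0 < l" "l < 1"
    and "h0 \<in> borel_measurable (Pi\<^sub>M I (\<lambda>_. lborel))" "h1 \<in> borel_measurable (Pi\<^sub>M I (\<lambda>_. lborel))"
      "h \<in> borel_measurable (Pi\<^sub>M I (\<lambda>_. lborel))"
    and "\<And>x y a b. x \<in> space (Pi\<^sub>M I (\<lambda>_. lborel)) \<Longrightarrow> y \<in> space (Pi\<^sub>M I (\<lambda>_. lborel)) \<Longrightarrow>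
        0 < a \<Longrightarrow> 0 < b \<Longrightarrow> ennreal a < h0 x \<Longrightarrow> ennreal b < h1 y \<Longrightarrow>
        ennreal (power_mean k l a b) \<le> h (\<lambda>i. (1 - l) * x i + l * y i)"
    and "0 < a" "ennreal a < (\<integral>\<^sup>+x. h0 x \<partial>Pi\<^sub>M I (\<lambda>_. lborel))"
    and "0 < b" "ennreal b < (\<integral>\<^sup>+x. h1 x \<partial>Pi\<^sub>M I (\<lambda>_. lborel))"
  shows "ennreal (power_mean (k + card I) l a b) \<le> (\<integral>\<^sup>+x. h x \<partial>Pi\<^sub>M I (\<lambda>_. lborel))"
  using assms(1,2,5-)
proof (induction I arbitrary: k h0 h1 h a b rule: finite_induct)
  case empty
  interpret product_sigma_finite "\<lambda>_::'i. lborel :: real measure" ..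
  have e: "(\<integral>\<^sup>+x. g x \<partial>Pi\<^sub>M {} (\<lambda>_::'i. lborel :: real measure)) = g (\<lambda>_. undefined)" for g
    by (simp add: PiM_empty nn_integral_count_space_finite)
  have "(\<lambda>i. (1 - l) * undefined + l * undefined) = (\<lambda>_::'i. undefined :: real)"
    by (simp add: algebra_simps)
  with empty show ?case
    using empty(5)[of "\<lambda>_. undefined" "\<lambda>_. undefined" a b] by (simp add: e space_PiM)
next
  case (insert i I)
  interpret product_sigma_finite "\<lambda>_::'i. lborel :: real measure" ..
  let ?P = "Pi\<^sub>M I (\<lambda>_::'i. lborel :: real measure)"
  let ?F = "\<lambda>h x. \<integral>\<^sup>+u. h (x(i := u)) \<partial>lborel"
  note [measurable] = insert.prems(2-4)
  have slice: "(\<lambda>u. g (x(i := u))) \<in> borel_measurable borel"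
    if "g \<in> borel_measurable (Pi\<^sub>M (insert i I) (\<lambda>_. lborel))" "x \<in> space ?P" for g :: "_ \<Rightarrow> ennreal" and x
    using measurable_comp[OF measurable_component_update that(1), OF that(2) insert.hyps(2)]
    by (simp add: comp_def fun_upd_def)
  have F: "?F g \<in> borel_measurable ?P"
    if [measurable]: "g \<in> borel_measurable (Pi\<^sub>M (insert i I) (\<lambda>_. lborel))" for g :: "_ \<Rightarrow> ennreal"
    by measurable
  have int: "(\<integral>\<^sup>+x. g x \<partial>Pi\<^sub>M (insert i I) (\<lambda>_. lborel)) = (\<integral>\<^sup>+x. ?F g x \<partial>?P)"
    if "g \<in> borel_measurable (Pi\<^sub>M (insert i I) (\<lambda>_. lborel))" for g :: "_ \<Rightarrow> ennreal"
    using that insert.hyps by (intro product_nn_integral_insert) auto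
  have "ennreal (power_mean ((k + 1) + card I) l a b) \<le> (\<integral>\<^sup>+x. ?F h x \<partial>?P)"
  proof (rule insert.IH[of "k + 1" "?F h0" "?F h1" "?F h"])
    fix x y a b assume x: "x \<in> space ?P" and y: "y \<in> space ?P" and ab: "0 < a" "0 < b"
      "ennreal a < ?F h0 x" "ennreal b < ?F h1 y"
    have z: "(\<lambda>i. (1 - l) * x i + l * y i) \<in> space ?P"
      \<comment> \<open>outside \<^term>\<open>I\<close> all points take the value \<^term>\<open>undefined\<close>, which affine combinations fix\<close>
      using x y by (auto simp: space_PiM PiE_def extensional_def algebra_simps)
    show "ennreal (power_mean (k + 1) l a b) \<le> ?F h (\<lambda>i. (1 - l) * x i + l * y i)"
    proof (rule Borell_Brascamp_Lieb_real[OF insert.prems(1) l])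
      fix u v a b assume "0 < a" "0 < b" "ennreal a < h0 (x(i := u))" "ennreal b < h1 (y(i := v))"
      moreover have "x(i := u) \<in> space (Pi\<^sub>M (insert i I) (\<lambda>_. lborel))" "y(i := v) \<in> space (Pi\<^sub>M (insert i I) (\<lambda>_. lborel))"
        using x y by (auto simp: space_PiM PiE_def extensional_def)
      moreover have "(\<lambda>j. (1 - l) * (x(i := u)) j + l * (y(i := v)) j)
          = (\<lambda>i. (1 - l) * x i + l * y i)(i := (1 - l) * u + l * v)" by auto
      ultimately show "ennreal (power_mean k l a b) \<le> h ((\<lambda>i. (1 - l) * x i + l * y i)(i := (1 - l) * u + l * v))"
        using insert.prems(5)[of "x(i := u)" "y(i := v)" a b] by metis
    qed (use ab slice x y z insert.prems in auto)
  next
    show "?F h0 \<in> borel_measurable ?P" "?F h1 \<in> borel_measurable ?P" "?F h \<in> borel_measurable ?P"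
      by (rule F, fact insert.prems)+
    show "ennreal a < (\<integral>\<^sup>+x. ?F h0 x \<partial>?P)" "ennreal b < (\<integral>\<^sup>+x. ?F h1 x \<partial>?P)"
      using insert.prems(7,9) int[OF insert.prems(2)] int[OF insert.prems(3)] by metis+
  qed (use insert.prems(1,6,8) in auto)
  moreover have "(k + 1) + card I = k + card (insert i I)" using insert.hyps by simp
  ultimately show ?case using int[OF insert.prems(4)] by metis
qed

text \<open>Transported from the product measure by the coordinate map, which is linear and
  therefore respects the affine combinations in \<open>H\<close>.\<close>

theorem Borell_Brascamp_Lieb:
  fixes h0 h1 h :: "'a::euclidean_space \<Rightarrow> ennreal"
  assumes k: "0 < k" and l: "0 < l" "l < 1"
    and m[measurable]: "h0 \<in> borel_measurable borel" "h1 \<in> borel_measurable borel" "h \<in> borel_measurable borel"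
    and H: "\<And>x y a b. 0 < a \<Longrightarrow> 0 < b \<Longrightarrow> ennreal a < h0 x \<Longrightarrow> ennreal b < h1 y \<Longrightarrow>
        ennreal (power_mean k l a b) \<le> h ((1 - l) *\<^sub>R x + l *\<^sub>R y)"
    and a: "0 < a" "ennreal a < (\<integral>\<^sup>+x. h0 x \<partial>lborel)" and b: "0 < b" "ennreal b < (\<integral>\<^sup>+x. h1 x \<partial>lborel)"
  shows "ennreal (power_mean (k + DIM('a)) l a b) \<le> (\<integral>\<^sup>+x. h x \<partial>lborel)"
proof -
  let ?P = "\<Pi>\<^sub>M b\<in>(Basis :: 'a set). (lborel :: real measure)"
  let ?T = "\<lambda>f. \<Sum>b\<in>(Basis :: 'a set). f b *\<^sub>R b"
  have T[measurable]: "?T \<in> measurable ?P borel" by measurable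
  have int: "(\<integral>\<^sup>+x. g x \<partial>lborel) = (\<integral>\<^sup>+x. g (?T x) \<partial>?P)" if "g \<in> borel_measurable borel" for g :: "'a \<Rightarrow> ennreal"
    using that by (subst lborel_eq) (simp add: nn_integral_distr)
  show ?thesis unfolding int[OF m(3)]
  proof (rule Borell_Brascamp_Lieb_PiM[where ?h0.0 = "\<lambda>x. h0 (?T x)" and ?h1.0 = "\<lambda>x. h1 (?T x)", OF finite_Basis k l])
    fix x y a b assume "0 < a" "0 < b" "ennreal a < h0 (?T x)" "ennreal b < h1 (?T y)"
    from H[OF this] show "ennreal (power_mean k l a b) \<le> h (?T (\<lambda>i. (1 - l) * x i + l * y i))"
      by (simp add: scaleR_sum_right scaleR_add_left sum.distrib)
  qed (use a b int m in \<open>auto\<close>)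
qed

section \<open>Moments of decaying functions on the half-line\<close>

text \<open>Nonnegativity makes gauge integrability absolute, so closed formulas stated with
  \<open>has_integral\<close> become values of Lebesgue integrals.\<close>

lemma set_lborel_of_has_integral:
  fixes f :: "'a::euclidean_space \<Rightarrow> real"
  assumes S: "S \<in> sets borel" and f: "f \<in> borel_measurable borel"
    and nn: "\<And>x. x \<in> S \<Longrightarrow> 0 \<le> f x" and I: "(f has_integral I) S"
  shows "set_integrable lborel S f" "(LINT x:S|lborel. f x) = I"
proof -
  have "set_integrable lebesgue S f"
    using I nn by (intro nonnegative_absolutely_integrable_1) auto
  moreover have "(\<lambda>x. indicator S x *\<^sub>R f x) \<in> borel_measurable lborel"
    using S f by measurable
  ultimately show i: "set_integrable lborel S f"
    unfolding set_integrable_def by (simp add: integrable_completion)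
  show "(LINT x:S|lborel. f x) = I"
    using set_borel_integral_eq_integral(2)[OF i] I by (simp add: integral_unique)
qed

lemma has_integral_Ioi_iff_Ici:
  fixes f :: "real \<Rightarrow> real"
  shows "(f has_integral I) {a<..} \<longleftrightarrow> (f has_integral I) {a..}"
  by (rule has_integral_spike_set_eq) (rule negligible_subset[of "{a}"]; auto)+

lemma set_integrable_powr_Ioc:
  assumes "-1 < a" "0 \<le> c"
  shows "set_integrable lborel {0<..c} (\<lambda>t::real. t powr a)"
    and "(LINT t:{0<..c}|lborel. t powr a) = c powr (a + 1) / (a + 1)"
proof -
  have "((\<lambda>t. t powr a) has_integral (c powr (a+1) / (a+1))) {0<..c}"
    using has_integral_powr_from_0[OF assms]
    by (rule has_integral_spike_set_eq[THEN iffD1, rotated 2]) (rule negligible_subset[of "{0}"]; auto)+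
  then show "set_integrable lborel {0<..c} (\<lambda>t::real. t powr a)"
    "(LINT t:{0<..c}|lborel. t powr a) = c powr (a + 1) / (a + 1)"
    by (rule set_lborel_of_has_integral[rotated 3]; simp)+
qed

lemma set_integrable_powr_Ioi:
  assumes "a < -1" "0 < c"
  shows "set_integrable lborel {c<..} (\<lambda>t::real. t powr a)"
    and "(LINT t:{c<..}|lborel. t powr a) = - (c powr (a + 1)) / (a + 1)"
proof -
  have "((\<lambda>t. t powr a) has_integral (- (c powr (a+1)) / (a+1))) {c<..}"
    unfolding has_integral_Ioi_iff_Ici using has_integral_powr_to_inf[OF assms] .
  then show "set_integrable lborel {c<..} (\<lambda>t::real. t powr a)"
    "(LINT t:{c<..}|lborel. t powr a) = - (c powr (a + 1)) / (a + 1)"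
    by (rule set_lborel_of_has_integral[rotated 3]; simp)+
qed

lemma set_integrable_powr_exp:
  assumes "-1 < a"
  shows "set_integrable lborel {0<..} (\<lambda>t::real. t powr a * exp (- t))"
    and "(LINT t:{0<..}|lborel. t powr a * exp (- t)) = Gamma (a + 1)"
proof -
  have "((\<lambda>t. t powr ((a + 1) - 1) / exp t) has_integral Gamma (a + 1)) {0<..}"
    unfolding has_integral_Ioi_iff_Ici using assms by (intro Gamma_integral_real) auto
  then have "((\<lambda>t. t powr a * exp (- t)) has_integral Gamma (a + 1)) {0<..}"
    by (simp add: exp_minus divide_inverse)
  then show "set_integrable lborel {0<..} (\<lambda>t::real. t powr a * exp (- t))"
    "(LINT t:{0<..}|lborel. t powr a * exp (- t)) = Gamma (a + 1)"
    by (rule set_lborel_of_has_integral[rotated 3]; simp)+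
qed

text \<open>A class on which the integrals for all indices above -1 converge. The linear bound on
  \<open>1 - g\<close> tames the weight near 0, and vanishing beyond some point settles the
  behaviour at infinity. It contains both the normalized covariograms and the extremal
  functions.\<close>

definition decay_profile :: "(real \<Rightarrow> real) \<Rightarrow> bool" where
  "decay_profile g \<longleftrightarrow> g \<in> borel_measurable borel \<and> (\<forall>t>0. 0 \<le> g t \<and> g t \<le> 1)
     \<and> (\<exists>C. \<forall>t>0. 1 - g t \<le> C * t) \<and> (\<exists>T. \<forall>t>T. g t = 0)"

lemma decay_profileD:
  assumes "decay_profile g"
  shows "g \<in> borel_measurable borel" "\<And>t. 0 < t \<Longrightarrow> 0 \<le> g t" "\<And>t. 0 < t \<Longrightarrow> g t \<le> 1"
  using assms by (auto simp: decay_profile_def)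

lemma decay_profile_bounds:
  assumes "decay_profile g"
  shows "\<exists>C>0. \<exists>T\<ge>1. (\<forall>t>0. 1 - g t \<le> C * t) \<and> (\<forall>t>T. g t = 0)"
proof -
  from assms obtain C T where C: "\<And>t. 0 < t \<Longrightarrow> 1 - g t \<le> C * t" and T: "\<And>t. T < t \<Longrightarrow> g t = 0"
    unfolding decay_profile_def by blast
  have "1 - g t \<le> max C 1 * t" if "0 < t" for t
    using C[OF that] that by (smt (verit) mult_right_mono)
  with T show ?thesis
    by (intro exI[of _ "max C 1"] exI[of _ "max T 1"] conjI allI impI) auto
qed

lemma set_integrable_powr_mult_bounded:
  fixes u w :: "real \<Rightarrow> real"
  assumes w: "set_integrable lborel {0<..} w" and u[measurable]: "u \<in> borel_measurable borel"
    and b: "\<And>t. 0 < t \<Longrightarrow> \<bar>t powr a * u t\<bar> \<le> w t"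
  shows "set_integrable lborel {0<..} (\<lambda>t. t powr a * u t)"
  using w unfolding set_integrable_def
proof (rule Bochner_Integration.integrable_bound)
  show "AE t in lborel. norm (indicator {0<..} t *\<^sub>R (t powr a * u t)) \<le> norm (indicator {0<..} t *\<^sub>R w t)"
    using b by (intro AE_I2) (force simp: indicator_def)
qed measurable

lemma set_integrable_Ioc_extend:
  fixes w :: "real \<Rightarrow> real"
  assumes "set_integrable lborel {0<..T} w"
  shows "set_integrable lborel {0<..} (\<lambda>t. indicator {..T} t * w t)"
proof -
  have "(\<lambda>t. indicator {0<..} t *\<^sub>R (indicator {..T} t * w t)) = (\<lambda>t. indicator {0<..T} t *\<^sub>R w t)"
    by (auto simp: indicator_def fun_eq_iff)
  with assms show ?thesis by (simp add: set_integrable_def)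
qed

lemma set_integrable_powr_compact:
  fixes u :: "real \<Rightarrow> real"
  assumes a: "-1 < a" and u: "u \<in> borel_measurable borel"
    and K: "\<And>t. 0 < t \<Longrightarrow> \<bar>u t\<bar> \<le> K" and T: "\<And>t. T < t \<Longrightarrow> u t = 0"
  shows "set_integrable lborel {0<..} (\<lambda>t. t powr a * u t)"
proof (rule set_integrable_powr_mult_bounded[OF _ u])
  have "set_integrable lborel {0<..max T 0} (\<lambda>t. t powr a)"
    using set_integrable_powr_Ioc(1)[OF a, of "max T 0"] by simp
  then show "set_integrable lborel {0<..} (\<lambda>t. indicator {..max T 0} t * (K * t powr a))"
    by (intro set_integrable_Ioc_extend set_integrable_mult_right) auto
  show "\<bar>t powr a * u t\<bar> \<le> indicator {..max T 0} t * (K * t powr a)" if "0 < t" for t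
    using K[OF that] T[of t] that
    by (auto simp: indicator_def abs_mult mult.commute[of K] intro!: mult_left_mono)
qed

text \<open>Both profiles are within O(t) of 1 near 0. Dividing the difference by \<open>t\<close>
  thus leaves a bounded function and raises the exponent of the weight to \<open>a\<close>, which
  exceeds -1.\<close>

lemma decay_profile_integrable_diff:
  assumes g: "decay_profile g" and h: "decay_profile h" and a: "-1 < a"
  shows "set_integrable lborel {0<..} (\<lambda>t. t powr (a - 1) * (g t - h t))"
proof -
  obtain C T where C: "0 < C" "1 \<le> T" "\<And>t. 0 < t \<Longrightarrow> 1 - g t \<le> C * t" "\<And>t. T < t \<Longrightarrow> g t = 0"
    using decay_profile_bounds[OF g] by metis
  obtain D S where D: "0 < D" "1 \<le> S" "\<And>t. 0 < t \<Longrightarrow> 1 - h t \<le> D * t" "\<And>t. S < t \<Longrightarrow> h t = 0"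
    using decay_profile_bounds[OF h] by metis
  note [measurable] = decay_profileD(1)[OF g] decay_profileD(1)[OF h]
  have "set_integrable lborel {0<..} (\<lambda>t. t powr a * ((g t - h t) / t))"
  proof (rule set_integrable_powr_compact[OF a])
    show "\<bar>(g t - h t) / t\<bar> \<le> C + D" if t: "0 < t" for t
    proof -
      have "\<bar>g t - h t\<bar> \<le> C * t + D * t"
        using C(3)[OF t] D(3)[OF t] decay_profileD(2,3)[OF g t] decay_profileD(2,3)[OF h t]
          mult_pos_pos[OF C(1) t] mult_pos_pos[OF D(1) t] by linarith
      with t show ?thesis by (simp add: abs_divide field_simps)
    qed
    show "(g t - h t) / t = 0" if "max T S < t" for t
      using C(4) D(4) that by auto
  qed measurable
  moreover have "set_integrable lborel {0<..} (\<lambda>t. t powr a * ((g t - h t) / t)) =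
      set_integrable lborel {0<..} (\<lambda>t. t powr (a - 1) * (g t - h t))"
    by (rule set_integrable_cong) (auto simp: powr_diff)
  ultimately show ?thesis by metis
qed

lemma decay_profile_integrable_pos:
  assumes g: "decay_profile g" and a: "0 < a"
  shows "set_integrable lborel {0<..} (\<lambda>t. t powr (a - 1) * g t)"
proof -
  obtain T where T: "\<And>t. T < t \<Longrightarrow> g t = 0"
    using decay_profile_bounds[OF g] by metis
  show ?thesis
    using decay_profileD[OF g] a T
    by (intro set_integrable_powr_compact[where K = 1 and T = T]) auto
qed

lemma decay_profile_indicator: "decay_profile (indicator {..1})"
  unfolding decay_profile_def
proof (intro conjI)
  show "\<exists>C. \<forall>t>0. 1 - indicator {..1} t \<le> C * (t::real)"
    by (intro exI[of _ 1]) (auto simp: indicator_def)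
  show "\<exists>T::real. \<forall>t>T. indicator {..1} t = (0::real)"
    by (intro exI[of _ 1]) (auto simp: indicator_def)
qed auto

text \<open>The indicator of \<open>{..1}\<close>, used as an auxiliary profile, splits
  \<open>1 - g\<close> into a tail, integrable because \<open>a\<close> is negative, and a
  difference of two profiles.\<close>

lemma decay_profile_integrable_neg:
  assumes g: "decay_profile g" and a: "-1 < a" "a < 0"
  shows "set_integrable lborel {0<..} (\<lambda>t. t powr (a - 1) * (1 - g t))"
proof -
  have "(\<lambda>t. indicator {0<..} t *\<^sub>R (indicator {1<..} t * t powr (a - 1))) = (\<lambda>t::real. indicator {1<..} t *\<^sub>R t powr (a - 1))"
    by (auto simp: indicator_def fun_eq_iff)
  then have 1: "set_integrable lborel {0<..} (\<lambda>t::real. indicator {1<..} t * t powr (a - 1))"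
    using set_integrable_powr_Ioi(1)[of "a - 1" 1] a by (simp add: set_integrable_def)
  have 2: "set_integrable lborel {0<..} (\<lambda>t. t powr (a - 1) * (indicator {..1} t - g t))"
    by (rule decay_profile_integrable_diff[OF decay_profile_indicator g a(1)])
  have "(\<lambda>t. indicator {1<..} t * t powr (a - 1) + t powr (a - 1) * (indicator {..1} t - g t)) = (\<lambda>t. t powr (a - 1) * (1 - g t))"
    by (auto simp: indicator_def fun_eq_iff algebra_simps)
  with set_integral_add(1)[OF 1 2] show ?thesis by simp
qed

text \<open>The constants do not depend on \<open>a\<close>; dominated convergence needs this
  uniformity when the index tends to 0.\<close>

lemma decay_profile_exp_bound:
  assumes g: "decay_profile g"
  shows "\<exists>K\<ge>0. \<exists>T\<ge>0. \<forall>a. \<forall>t>0.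
      \<bar>t powr (a - 1) * (g t - exp (- t))\<bar> \<le> indicator {..T} t * (K * t powr a) + t powr a * exp (- t)"
proof -
  obtain C T where C: "0 < C" "1 \<le> T" "\<And>t. 0 < t \<Longrightarrow> 1 - g t \<le> C * t" "\<And>t. T < t \<Longrightarrow> g t = 0"
    using decay_profile_bounds[OF g] by metis
  have "\<bar>t powr (a - 1) * (g t - exp (- t))\<bar> \<le> indicator {..T} t * ((C + 1) * t powr a) + t powr a * exp (- t)"
    if t: "0 < t" for a t
  proof -
    have e: "\<bar>g t - exp (- t)\<bar> \<le> t * (indicator {..T} t * (C + 1) + exp (- t))"
    proof (cases "t \<le> T")
      case True
      have "1 - exp (- t) \<le> t" using exp_ge_add_one_self[of "- t"] by simp
      moreover have "exp (- t) \<le> 1" using t by simp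
      ultimately have "\<bar>g t - exp (- t)\<bar> \<le> C * t + t"
        using C(3)[OF t] decay_profileD(2,3)[OF g t] mult_pos_pos[OF C(1) t] by linarith
      also have "\<dots> \<le> t * (C + 1 + exp (- t))" using t by (simp add: algebra_simps)
      finally show ?thesis using True by simp
    next
      case False
      \<comment> \<open>Beyond \<open>T\<close> only \<open>exp (- t)\<close> is left, and
        \<open>t \<ge> 1\<close> there supplies the factor \<open>t\<close>.\<close>
      then have "1 * exp (- t) \<le> t * exp (- t)" using C(2) by (intro mult_right_mono) auto
      with False C(4)[of t] show ?thesis by simp
    qed
    have "\<bar>t powr (a - 1) * (g t - exp (- t))\<bar> = t powr (a - 1) * \<bar>g t - exp (- t)\<bar>"
      by (simp add: abs_mult)
    also have "\<dots> \<le> t powr (a - 1) * (t * (indicator {..T} t * (C + 1) + exp (- t)))"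
      using e by (intro mult_left_mono) auto
    also have "\<dots> = t powr a * (indicator {..T} t * (C + 1) + exp (- t))"
      using t by (simp add: powr_diff)
    finally show ?thesis by (simp add: algebra_simps)
  qed
  then show ?thesis
    using C by (intro exI[of _ "C + 1"] exI[of _ T] conjI allI impI) auto
qed

lemma decay_profile_integrable_exp:
  assumes g: "decay_profile g" and a: "-1 < a"
  shows "set_integrable lborel {0<..} (\<lambda>t. t powr (a - 1) * (g t - exp (- t)))"
proof -
  obtain K T where K: "\<And>a t. 0 < t \<Longrightarrow>
      \<bar>t powr (a - 1) * (g t - exp (- t))\<bar> \<le> indicator {..T} t * (K * t powr a) + t powr a * exp (- t)" "0 \<le> K" "0 \<le> T"
    using decay_profile_exp_bound[OF g] by metis
  note [measurable] = decay_profileD(1)[OF g]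
  show ?thesis
  proof (rule set_integrable_powr_mult_bounded[OF _ _ K(1)])
    show "set_integrable lborel {0<..} (\<lambda>t. indicator {..T} t * (K * t powr a) + t powr a * exp (- t))"
      using a K by (intro set_integral_add set_integrable_powr_exp set_integrable_Ioc_extend
          set_integrable_mult_right set_integrable_powr_Ioc) auto
  qed auto
qed

text \<open>Carries formulas known for positive exponents over to index 0.\<close>

lemma decay_profile_exp_tendsto:
  assumes g: "decay_profile g"
  shows "(\<lambda>n. LINT t:{0<..}|lborel. t powr (inverse (Suc n) - 1) * (g t - exp (- t)))
           \<longlonglongrightarrow> (LINT t:{0<..}|lborel. t powr (0 - 1) * (g t - exp (- t)))"
proof -
  obtain K T where K: "\<And>a t. 0 < t \<Longrightarrow>
      \<bar>t powr (a - 1) * (g t - exp (- t))\<bar> \<le> indicator {..T} t * (K * t powr a) + t powr a * exp (- t)" "0 \<le> K" "0 \<le> T"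
    using decay_profile_exp_bound[OF g] by metis
  note [measurable] = decay_profileD(1)[OF g]
  let ?b = "\<lambda>a t. indicator {..T} t * (K * t powr a) + t powr a * exp (- t)"
  have ib: "set_integrable lborel {0<..} (?b a)" if "-1 < a" for a
    using that K by (intro set_integral_add set_integrable_powr_exp set_integrable_Ioc_extend
          set_integrable_mult_right set_integrable_powr_Ioc) auto
  show ?thesis
    unfolding set_lebesgue_integral_def
  proof (rule integral_dominated_convergence[where w = "\<lambda>t. indicator {0<..} t *\<^sub>R (?b 0 t + ?b 1 t)"])
    show "integrable lborel (\<lambda>t. indicator {0<..} t *\<^sub>R (?b 0 t + ?b 1 t))"
      using set_integral_add(1)[OF ib[of 0] ib[of 1]] by (simp add: set_integrable_def)
    show "AE t in lborel. (\<lambda>n. indicator {0<..} t *\<^sub>R (t powr (inverse (Suc n) - 1) * (g t - exp (- t))))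
        \<longlonglongrightarrow> indicator {0<..} t *\<^sub>R (t powr (0 - 1) * (g t - exp (- t)))"
    proof (intro AE_I2)
      fix t :: real
      show "(\<lambda>n. indicator {0<..} t *\<^sub>R (t powr (inverse (Suc n) - 1) * (g t - exp (- t))))
        \<longlonglongrightarrow> indicator {0<..} t *\<^sub>R (t powr (0 - 1) * (g t - exp (- t)))"
      proof (cases "0 < t")
        case True
        then show ?thesis
          by (intro tendsto_scaleR tendsto_mult tendsto_powr tendsto_diff tendsto_const LIMSEQ_inverse_real_of_nat) auto
      qed (simp add: indicator_def)
    qed
    show "AE t in lborel. norm (indicator {0<..} t *\<^sub>R (t powr (inverse (Suc n) - 1) * (g t - exp (- t))))
        \<le> indicator {0<..} t *\<^sub>R (?b 0 t + ?b 1 t)" for n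
    proof (intro AE_I2)
      fix t :: real
      show "norm (indicator {0<..} t *\<^sub>R (t powr (inverse (Suc n) - 1) * (g t - exp (- t))))
        \<le> indicator {0<..} t *\<^sub>R (?b 0 t + ?b 1 t)"
      proof (cases "0 < t")
        case True
        let ?a = "inverse (real (Suc n))"
        have "?a \<le> 1" by (simp add: inverse_le_1_iff)
        \<comment> \<open>All exponents lie between 0 and 1, so the powers 0 and 1 together dominate
          on both sides of \<open>t = 1\<close>. Hence the sum of the two bounds \<open>?b 0\<close>
          and \<open>?b 1\<close> is a majorant for every \<open>n\<close>.\<close>
        then have p: "t powr ?a \<le> t powr 0 + t powr 1"
          using True powr_le1[of ?a t] powr_mono[of ?a 1 t] by (cases "t \<le> 1") auto
        have "\<bar>t powr (?a - 1) * (g t - exp (- t))\<bar> \<le> t powr ?a * (indicator {..T} t * K + exp (- t))"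
          using K(1)[OF True, of ?a] by (simp add: algebra_simps)
        also have "\<dots> \<le> (t powr 0 + t powr 1) * (indicator {..T} t * K + exp (- t))"
          using p K(2) by (intro mult_right_mono) (auto simp: indicator_def)
        also have "\<dots> = ?b 0 t + ?b 1 t" by (simp add: algebra_simps)
        finally show ?thesis using True by simp
      qed simp
    qed
  qed measurable
qed

text \<open>The radial function of the radial mean body, expressed through the normalized covariogram.\<close>

definition moment_radius :: "(real \<Rightarrow> real) \<Rightarrow> real \<Rightarrow> real" where
  "moment_radius g a =
    (if 0 < a then (a * (LINT t:{0<..}|lborel. t powr (a - 1) * g t)) powr (1 / a)
     else if a < 0 then (\<bar>a\<bar> * (LINT t:{0<..}|lborel. t powr (a - 1) * (1 - g t))) powr (1 / a)
     else exp (- euler_mascheroni + (LINT t:{0<..}|lborel. t powr (a - 1) * (g t - exp (- t)))))"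

lemma moment_pos:
  assumes g: "decay_profile g" and a: "0 < a"
  shows "0 < (LINT t:{0<..}|lborel. t powr (a - 1) * g t)"
proof -
  obtain C where C: "0 < C" "\<And>t. 0 < t \<Longrightarrow> 1 - g t \<le> C * t"
    using decay_profile_bounds[OF g] by metis
  \<comment> \<open>The linear bound keeps \<open>g\<close> at or above 1/2 up to this
    point.\<close>
  define d where "d = 1 / (2 * C)"
  have d: "0 < d" using C by (simp add: d_def)
  have "0 < (LINT t:{0<..d}|lborel. t powr (a - 1)) * (1/2)"
    using a d by (simp add: set_integrable_powr_Ioc(2))
  also have "\<dots> = (LINT t:{0<..d}|lborel. t powr (a - 1) * (1/2))"
    by (rule set_integral_mult_left[symmetric])
  also have "\<dots> \<le> (LINT t:{0<..}|lborel. t powr (a - 1) * g t)"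
    unfolding set_lebesgue_integral_def
  proof (rule integral_mono)
    show "integrable lborel (\<lambda>t. indicator {0<..d} t *\<^sub>R (t powr (a - 1) * (1/2)))"
      unfolding set_integrable_def[symmetric]
      using set_integrable_powr_Ioc(1)[of "a - 1" d] a d by (intro set_integrable_mult_left) auto
    show "integrable lborel (\<lambda>t. indicator {0<..} t *\<^sub>R (t powr (a - 1) * g t))"
      using decay_profile_integrable_pos[OF g a] by (simp add: set_integrable_def)
    fix t :: real
    have "1 / 2 \<le> g t" if "0 < t" "t \<le> d"
    proof -
      have "C * t \<le> 1 / 2" using that C(1) by (simp add: d_def field_simps)
      with C(2)[OF that(1)] show ?thesis by linarith
    qed
    then show "indicator {0<..d} t *\<^sub>R (t powr (a - 1) * (1/2)) \<le> indicator {0<..} t *\<^sub>R (t powr (a - 1) * g t)"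
      using decay_profileD(2)[OF g, of t] by (auto simp: indicator_def intro!: mult_left_mono[of "1/2", simplified])
  qed
  finally show ?thesis .
qed

lemma moment_neg_pos:
  assumes g: "decay_profile g" and a: "-1 < a" "a < 0"
  shows "0 < (LINT t:{0<..}|lborel. t powr (a - 1) * (1 - g t))"
proof -
  obtain T where T: "1 \<le> T" "\<And>t. T < t \<Longrightarrow> g t = 0"
    using decay_profile_bounds[OF g] by metis
  have "0 < (LINT t:{T<..}|lborel. t powr (a - 1))"
    using a T by (simp add: set_integrable_powr_Ioi(2) divide_less_0_iff)
  also have "\<dots> \<le> (LINT t:{0<..}|lborel. t powr (a - 1) * (1 - g t))"
    unfolding set_lebesgue_integral_def
  proof (rule integral_mono)
    show "integrable lborel (\<lambda>t. indicator {T<..} t *\<^sub>R (t powr (a - 1)))"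
      using set_integrable_powr_Ioi(1)[of "a - 1" T] a T by (auto simp: set_integrable_def)
    show "integrable lborel (\<lambda>t. indicator {0<..} t *\<^sub>R (t powr (a - 1) * (1 - g t)))"
      using decay_profile_integrable_neg[OF g a] by (simp add: set_integrable_def)
    fix t :: real
    show "indicator {T<..} t *\<^sub>R (t powr (a - 1)) \<le> indicator {0<..} t *\<^sub>R (t powr (a - 1) * (1 - g t))"
      using decay_profileD(3)[OF g, of t] T by (auto simp: indicator_def)
  qed
  finally show ?thesis .
qed

lemma moment_radius_pos:
  assumes "decay_profile g" "-1 < a"
  shows "0 < moment_radius g a"
  using moment_pos[OF assms(1), of a] moment_neg_pos[OF assms]
  by (auto simp: moment_radius_def)

text \<open>Subtracting the formulas for \<open>g\<close> and \<open>h\<close> removes the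
  references 1 and \<open>exp (- t)\<close>. For negative \<open>a\<close> two reversals cancel:
  \<open>1 - g\<close> decreases in \<open>g\<close>, and the power \<open>1 / a\<close> is
  decreasing.\<close>

lemma moment_radius_le_iff:
  assumes g: "decay_profile g" and h: "decay_profile h" and a: "-1 < a"
  shows "moment_radius g a \<le> moment_radius h a \<longleftrightarrow>
    (LINT t:{0<..}|lborel. t powr (a - 1) * (g t - h t)) \<le> 0"
proof -
  consider "0 < a" | "a < 0" | "a = 0" by linarith
  then show ?thesis
  proof cases
    case 1
    define G where "G = (LINT t:{0<..}|lborel. t powr (a - 1) * g t)"
    define H where "H = (LINT t:{0<..}|lborel. t powr (a - 1) * h t)"
    have "(LINT t:{0<..}|lborel. t powr (a - 1) * (g t - h t)) = G - H"
      unfolding G_def H_def right_diff_distrib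
      using decay_profile_integrable_pos[OF g 1] decay_profile_integrable_pos[OF h 1]
      by (rule set_integral_diff(2))
    moreover have "0 < G" "0 < H" using moment_pos 1 g h by (auto simp: G_def H_def)
    moreover have "moment_radius g a = (a * G) powr (1 / a)" "moment_radius h a = (a * H) powr (1 / a)"
      using 1 by (auto simp: moment_radius_def G_def H_def)
    moreover have "x powr (1 / a) \<le> y powr (1 / a) \<longleftrightarrow> x \<le> y" if "0 < x" "0 < y" for x y
      using that 1 by (simp add: powr_def divide_le_cancel)
    ultimately show ?thesis using 1 by simp
  next
    case 2
    define G where "G = (LINT t:{0<..}|lborel. t powr (a - 1) * (1 - g t))"
    define H where "H = (LINT t:{0<..}|lborel. t powr (a - 1) * (1 - h t))"
    have "(LINT t:{0<..}|lborel. t powr (a - 1) * (g t - h t)) =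
        (LINT t:{0<..}|lborel. t powr (a - 1) * (1 - h t) - t powr (a - 1) * (1 - g t))"
      by (simp add: algebra_simps)
    also have "\<dots> = H - G"
      unfolding G_def H_def
      using decay_profile_integrable_neg[OF h a 2] decay_profile_integrable_neg[OF g a 2]
      by (rule set_integral_diff(2))
    finally have "(LINT t:{0<..}|lborel. t powr (a - 1) * (g t - h t)) = H - G" .
    moreover have "0 < G" "0 < H" using moment_neg_pos a 2 g h by (auto simp: G_def H_def)
    moreover have "moment_radius g a = (\<bar>a\<bar> * G) powr (1 / a)" "moment_radius h a = (\<bar>a\<bar> * H) powr (1 / a)"
      using 2 by (auto simp: moment_radius_def G_def H_def)
    moreover have "x powr (1 / a) \<le> y powr (1 / a) \<longleftrightarrow> y \<le> x" if "0 < x" "0 < y" for x y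
      using that 2 by (simp add: powr_def divide_le_cancel)
    moreover have "0 < \<bar>a\<bar>" using 2 by simp
    ultimately show ?thesis by (simp del: abs_of_neg zero_less_abs_iff)
  next
    case 3
    have "(LINT t:{0<..}|lborel. t powr (a - 1) * (g t - h t)) =
        (LINT t:{0<..}|lborel. t powr (a - 1) * (g t - exp (- t)) - t powr (a - 1) * (h t - exp (- t)))"
      by (simp add: algebra_simps)
    also have "\<dots> = (LINT t:{0<..}|lborel. t powr (a - 1) * (g t - exp (- t))) - (LINT t:{0<..}|lborel. t powr (a - 1) * (h t - exp (- t)))"
      using decay_profile_integrable_exp[OF g a] decay_profile_integrable_exp[OF h a]
      by (rule set_integral_diff(2))
    finally show ?thesis using 3 by (simp add: moment_radius_def)
  qed
qed

text \<open>Bernoulli's inequality for real exponents: \<open>(1 - x) powr m + m * x\<close> has a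
  nonnegative derivative. The endpoint \<open>u = 1\<close> is separate because there the base of
  the power reaches 0.\<close>

lemma one_minus_powr_ge:
  assumes m: "1 \<le> m" and u: "0 \<le> u" "u \<le> (1::real)"
  shows "1 - m * u \<le> (1 - u) powr m"
proof (cases "u = 1")
  case False
  have "(1 - 0) powr m - 1 + m * 0 \<le> (1 - u) powr m - 1 + m * u"
  proof (rule DERIV_nonneg_imp_nondecreasing[OF u(1)])
    fix x assume x: "0 \<le> x" "x \<le> u"
    have "((\<lambda>x. (1 - x) powr m - 1 + m * x) has_real_derivative m * (1 - (1 - x) powr (m - 1))) (at x)"
      using x u False by (auto intro!: derivative_eq_intros DERIV_fun_powr[where m = "-1"] simp: algebra_simps)
    moreover have "(1 - x) powr (m - 1) \<le> 1" using x u m by (intro powr_le1) auto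
    ultimately show "\<exists>y. ((\<lambda>x. (1 - x) powr m - 1 + m * x) has_real_derivative y) (at x) \<and> 0 \<le> y"
      using m by (intro exI[of _ "m * (1 - (1 - x) powr (m - 1))"]) auto
  qed
  then show ?thesis by simp
qed (use m in auto)

section \<open>Moments of the extremal functions and the normalizing factor\<close>

definition model_profile :: "real \<Rightarrow> real \<Rightarrow> real \<Rightarrow> real" where
  "model_profile m L t = max 0 (1 - t / L) powr m"

lemma decay_profile_model:
  assumes m: "1 < m" and L: "0 < L"
  shows "decay_profile (model_profile m L)"
  unfolding decay_profile_def
proof (intro conjI allI impI)
  show "model_profile m L \<in> borel_measurable borel"
    unfolding model_profile_def by measurable
  show "model_profile m L t \<le> 1" if "0 < t" for t
    unfolding model_profile_def using that m L by (intro powr_le1) auto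
  have "1 - model_profile m L t \<le> m / L * t" if "0 < t" for t
  proof (cases "t \<le> L")
    case True
    then show ?thesis
      using one_minus_powr_ge[of m "t / L"] m L that by (simp add: model_profile_def max_def)
  next
    case False
    then have "L * 1 \<le> t * m" using m L by (intro mult_mono) auto
    then have "1 \<le> m / L * t" using L by (simp add: field_simps)
    moreover have "0 \<le> model_profile m L t" by (simp add: model_profile_def)
    ultimately show ?thesis by linarith
  qed
  then show "\<exists>C. \<forall>t>0. 1 - model_profile m L t \<le> C * t" by blast
  show "\<exists>T. \<forall>t>T. model_profile m L t = 0"
    using L by (intro exI[of _ L]) (auto simp: model_profile_def max_def)
qed (simp add: model_profile_def)

lemma set_integral_powr_scale:
  fixes u :: "real \<Rightarrow> real"
  assumes L: "0 < L"
  shows "(LINT t:{0<..}|lborel. t powr (a - 1) * u (t / L)) = L powr a * (LINT t:{0<..}|lborel. t powr (a - 1) * u t)"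
proof -
  have "(LINT t:{0<..}|lborel. t powr (a - 1) * u (t / L)) =
      \<bar>L\<bar> *\<^sub>R (LINT t|lborel. indicator {0<..} (0 + L * t) *\<^sub>R ((0 + L * t) powr (a - 1) * u ((0 + L * t) / L)))"
    unfolding set_lebesgue_integral_def using L by (intro lborel_integral_real_affine) auto
  also have "(LINT t|lborel. indicator {0<..} (0 + L * t) *\<^sub>R ((0 + L * t) powr (a - 1) * u ((0 + L * t) / L))) =
      (LINT t|lborel. L powr (a - 1) * (indicator {0<..} t *\<^sub>R (t powr (a - 1) * u t)))"
    using L by (intro Bochner_Integration.integral_cong) (auto simp: indicator_def zero_less_mult_iff powr_mult)
  also have "\<dots> = L powr (a - 1) * (LINT t:{0<..}|lborel. t powr (a - 1) * u t)"
    by (simp add: set_lebesgue_integral_def)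
  finally show ?thesis using L by (simp add: powr_diff)
qed

lemma pos_notin_nonpos_Ints: "0 < x \<Longrightarrow> (x::real) \<notin> \<int>\<^sub>\<le>\<^sub>0"
  by (auto elim!: nonpos_Ints_cases)

text \<open>Scaling reduces the claim to \<open>L = 1\<close>, where the integral is
  \<open>Beta a (m + 1)\<close>. The recurrences of Beta trade \<open>a * Beta a (m + 1)\<close> for
  \<open>m * Beta (a + 1) m\<close>, an expression whose arguments stay positive for all
  \<open>a > -1\<close>.\<close>

lemma model_moment_pos:
  assumes m: "0 < m" and a: "0 < a" and L: "0 < L"
  shows "a * (LINT t:{0<..}|lborel. t powr (a - 1) * model_profile m L t) = L powr a * (m * Beta (a + 1) m)"
proof -
  have "(LINT t:{0..1}|lborel. t powr (a - 1) * (1 - t) powr (m + 1 - 1)) = Beta a (m + 1)"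
    by (rule set_lborel_of_has_integral(2)) (use has_integral_Beta_real[of a "m + 1"] m a in auto)
  moreover have "(LINT t:{0<..}|lborel. t powr (a - 1) * model_profile m 1 t) =
      (LINT t:{0..1}|lborel. t powr (a - 1) * (1 - t) powr (m + 1 - 1))"
    unfolding set_lebesgue_integral_def
    by (intro Bochner_Integration.integral_cong) (auto simp: indicator_def model_profile_def max_def)
  ultimately have 1: "(LINT t:{0<..}|lborel. t powr (a - 1) * model_profile m 1 t) = Beta a (m + 1)"
    by simp
  have "a * Beta a (m + 1) = (a + (m + 1)) * Beta (a + 1) (m + 1)"
    using a by (intro Beta_plus1_left[symmetric] pos_notin_nonpos_Ints)
  also have "\<dots> = m * Beta (a + 1) m"
    using Beta_plus1_right[OF pos_notin_nonpos_Ints[OF m], of "a + 1"] by (simp add: add_ac)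
  finally show ?thesis
    using set_integral_powr_scale[OF L, of a "model_profile m 1"] 1 by (simp add: model_profile_def)
qed

text \<open>Integration by parts with boundary term \<open>F\<close>, which runs from 0 to 1.
  Differentiating \<open>(1 - t) powr m\<close> contributes the Beta integral, now with positive
  first argument \<open>a + 1\<close>.\<close>

lemma has_integral_model_neg:
  fixes m a :: real
  assumes m: "1 < m" and a: "-1 < a" "a < 0"
  shows "((\<lambda>t. t powr (a - 1) * (1 - (1 - t) powr m)) has_integral (m * Beta (a + 1) m - 1) / (- a)) {0..1}"
proof -
  define F where "F = (\<lambda>t::real. t powr a * (1 - (1 - t) powr m))"
  define F' where "F' = (\<lambda>t::real. a * (t powr (a - 1) * (1 - (1 - t) powr m)) + m * (t powr a * (1 - t) powr (m - 1)))"
  have "(F' has_integral F 1 - F 0) {0..1}"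
  proof (rule fundamental_theorem_of_calculus_interior)
    fix t :: real assume t: "t \<in> {0<..<1}"
    have d1: "((\<lambda>t. t powr a) has_real_derivative a * t powr (a - 1)) (at t)"
      using t by (intro has_real_derivative_powr) auto
    have d2: "((\<lambda>t. (1 - t) powr m) has_real_derivative m * (1 - t) powr (m - of_nat 1) * (-1)) (at t)"
      using t by (intro DERIV_fun_powr) (auto intro!: derivative_eq_intros)
    have "(F has_real_derivative F' t) (at t)"
      unfolding F_def F'_def
      by (rule DERIV_cong[OF DERIV_mult[OF d1 DERIV_diff[OF DERIV_const d2]]]) (simp add: algebra_simps)
    then show "(F has_vector_derivative F' t) (at t)"
      by (simp add: has_real_derivative_iff_has_vector_derivative)
  next
    show "continuous_on {0..1} F"
      unfolding continuous_on_def
    proof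
      fix x :: real assume x: "x \<in> {0..1}"
      have c: "((\<lambda>t. (1 - t) powr m) \<longlongrightarrow> (1 - x) powr m) (at x within {0..1})"
        using m by (intro tendsto_powr' tendsto_intros) (auto simp: eventually_at_filter)
      show "(F \<longlongrightarrow> F x) (at x within {0..1})"
      \<comment> \<open>At 0 the factor \<open>t powr a\<close> is unbounded. Bernoulli's inequality
        bounds \<open>F t\<close> by \<open>m * t powr (a + 1)\<close>, which tends to 0.\<close>
      proof (cases "x = 0")
        case False
        then show ?thesis unfolding F_def
          by (intro tendsto_mult tendsto_diff c tendsto_powr tendsto_intros) auto
      next
        case True
        have "((\<lambda>t::real. t powr (a + 1)) \<longlongrightarrow> 0 powr (a + 1)) (at 0 within {0..1})"
          using a by (intro tendsto_powr' tendsto_intros) (auto simp: eventually_at_filter)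
        then have lim: "((\<lambda>t::real. m * t powr (a + 1)) \<longlongrightarrow> 0) (at 0 within {0..1})"
          by (intro tendsto_mult_right_zero) simp
        have "(F \<longlongrightarrow> 0) (at 0 within {0..1})"
        proof (rule tendsto_sandwich[OF _ _ tendsto_const lim])
          show "\<forall>\<^sub>F t in at 0 within {0..1}. 0 \<le> F t"
            unfolding eventually_at_filter F_def
            by (intro always_eventually) (use m in \<open>auto intro!: mult_nonneg_nonneg powr_le1\<close>)
          have "F t \<le> m * t powr (a + 1)" if "t \<in> {0..1}" for t
          proof -
            have "F t \<le> t powr a * (m * t)"
              unfolding F_def using one_minus_powr_ge[of m t] m that by (intro mult_left_mono) auto
            also have "\<dots> = m * t powr (a + 1)"
              using that by (cases "t = 0") (auto simp: powr_add)
            finally show ?thesis .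
          qed
          then show "\<forall>\<^sub>F t in at 0 within {0..1}. F t \<le> m * t powr (a + 1)"
            unfolding eventually_at_filter by (intro always_eventually) auto
        qed
        then show ?thesis using True by (simp add: F_def)
      qed
    qed
  qed simp
  then have "(F' has_integral 1) {0..1}" by (simp add: F_def)
  moreover have "((\<lambda>t. m * (t powr a * (1 - t) powr (m - 1))) has_integral m * Beta (a + 1) m) {0..1}"
    using has_integral_Beta_real[of "a + 1" m] m a by (intro has_integral_mult_right) auto
  ultimately have "((\<lambda>t. (m * (t powr a * (1 - t) powr (m - 1)) - F' t) * (1 / (- a)))
      has_integral (m * Beta (a + 1) m - 1) * (1 / (- a))) {0..1}"
    by (intro has_integral_mult_left has_integral_diff)
  then show ?thesis using a by (simp add: F'_def)
qed

text \<open>Beyond 1 the integrand is the bare weight and contributes \<open>1 / (- a)\<close>. This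
  cancels the boundary term left by the integration by parts on the unit interval, so the closed
  form is the one for positive indices.\<close>

lemma model_moment_neg:
  assumes m: "1 < m" and a: "-1 < a" "a < 0" and L: "0 < L"
  shows "\<bar>a\<bar> * (LINT t:{0<..}|lborel. t powr (a - 1) * (1 - model_profile m L t)) = L powr a * (m * Beta (a + 1) m)"
proof -
  let ?h = "\<lambda>t. t powr (a - 1) * (1 - model_profile m 1 t)"
  have 1: "(?h has_integral (m * Beta (a + 1) m - 1) / (- a)) {0..1}"
    using has_integral_model_neg[OF m a]
    by (rule has_integral_eq[rotated]) (auto simp: model_profile_def)
  have "(?h has_integral - (1 powr (a - 1 + 1)) / (a - 1 + 1)) {1..}"
    using has_integral_powr_to_inf[of "a - 1" 1] a
    by (intro has_integral_eq[OF _ has_integral_powr_to_inf[of "a - 1" 1]]) (auto simp: model_profile_def max_def)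
  with 1 have "(?h has_integral ((m * Beta (a + 1) m - 1) / (- a) + - (1 powr (a - 1 + 1)) / (a - 1 + 1))) ({0..1} \<union> {1..})"
    by (rule has_integral_Un) (rule negligible_subset[of "{1}"]; auto)
  moreover have "{0..1} \<union> {1..} = {0::real..}" by auto
  moreover have "(m * Beta (a + 1) m - 1) / (- a) + - (1 powr (a - 1 + 1)) / (a - 1 + 1) = m * Beta (a + 1) m / (- a)"
    using a by (simp add: field_simps)
  ultimately have "(?h has_integral m * Beta (a + 1) m / (- a)) {0<..}"
    unfolding has_integral_Ioi_iff_Ici by simp
  then have 1: "(LINT t:{0<..}|lborel. ?h t) = m * Beta (a + 1) m / (- a)"
    using decay_profileD(3)[OF decay_profile_model[OF m, of 1]] decay_profileD(1)[OF decay_profile_model[OF m, of 1]]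
    by (intro set_lborel_of_has_integral) auto
  then show ?thesis
    using set_integral_powr_scale[OF L, of a "\<lambda>t. 1 - model_profile m 1 t"] a by (simp add: model_profile_def)
qed

text \<open>The derivative at 0 of \<open>\<lambda>a. m * Beta (a + 1) m\<close>, and equally of its
  logarithm, since the value at 0 is 1. For a positive integer \<open>m\<close> it is minus the
  \<open>m\<close>-th harmonic number.\<close>

definition model_log_derivative :: "real \<Rightarrow> real" where
  "model_log_derivative m = - euler_mascheroni - Digamma (1 + m)"

lemma model_moment_derivative:
  assumes m: "0 < m"
  shows "m * Beta (0 + 1) m = 1"
    "((\<lambda>a. m * Beta (a + 1) m) has_real_derivative model_log_derivative m) (at 0)"
proof -
  show 1: "m * Beta (0 + 1) m = 1"
  proof -
    have "Gamma m \<noteq> 0" using Gamma_real_pos[OF m] by (metis less_irrefl)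
    then show ?thesis
      using m Gamma_plus1[OF pos_notin_nonpos_Ints[OF m]] by (simp add: Beta_def add.commute)
  qed
  have "((\<lambda>x. Beta x m) has_real_derivative Beta (0 + 1) m * (Digamma (0 + 1) - Digamma (0 + 1 + m))) (at (0 + 1))"
    using m by (intro has_field_derivative_Beta1 pos_notin_nonpos_Ints) auto
  then have "((\<lambda>a. Beta (a + 1) m) has_real_derivative Beta (0 + 1) m * (Digamma (0 + 1) - Digamma (0 + 1 + m))) (at 0)"
    by (simp only: DERIV_shift)
  then have "((\<lambda>a. m * Beta (a + 1) m) has_real_derivative m * (Beta (0 + 1) m * (Digamma (0 + 1) - Digamma (0 + 1 + m)))) (at 0)"
    by (rule DERIV_cmult)
  also have "m * (Beta (0 + 1) m * (Digamma (0 + 1) - Digamma (0 + 1 + m))) = (m * Beta (0 + 1) m) * (Digamma (0 + 1) - Digamma (0 + 1 + m))"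
    by simp
  finally show "((\<lambda>a. m * Beta (a + 1) m) has_real_derivative model_log_derivative m) (at 0)"
    unfolding 1 by (simp add: model_log_derivative_def)
qed

lemma Beta_real_pos: "0 < x \<Longrightarrow> 0 < y \<Longrightarrow> 0 < Beta x (y::real)"
  by (simp add: Beta_def Gamma_real_pos)

text \<open>The base of the power equals 1 at index 0, so the logarithm of the whole expression is a
  difference quotient at 0 of \<open>ln (m * Beta (a + 1) m)\<close>.\<close>

lemma norm_factor_0:
  assumes m: "0 < m"
  shows "norm_factor m 0 = exp (model_log_derivative m)"
proof -
  have "((\<lambda>a. ln (m * Beta (a + 1) m)) has_real_derivative (1 / (m * Beta (0 + 1) m)) * model_log_derivative m) (at 0)"
    using model_moment_derivative[OF m]
    by (intro DERIV_chain2[OF DERIV_ln_divide]) auto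
  then have "((\<lambda>a. ln (m * Beta (a + 1) m)) has_real_derivative model_log_derivative m) (at 0)"
    unfolding model_moment_derivative(1)[OF m] by simp
  then have "((\<lambda>a. (ln (m * Beta (0 + a + 1) m) - ln (m * Beta (0 + 1) m)) / a) \<longlongrightarrow> model_log_derivative m) (at 0)"
    by (simp only: DERIV_def)
  then have "((\<lambda>a. ln (m * Beta (a + 1) m) / a) \<longlongrightarrow> model_log_derivative m) (at 0)"
    unfolding model_moment_derivative(1)[OF m] by simp
  then have "((\<lambda>a. exp (ln (m * Beta (a + 1) m) / a)) \<longlongrightarrow> exp (model_log_derivative m)) (at 0)"
    by (rule tendsto_exp)
  moreover have "\<forall>\<^sub>F a in at 0. exp (ln (m * Beta (a + 1) m) / a) = (m * Beta (a + 1) m) powr (1 / a)"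
  proof -
    have "\<forall>\<^sub>F a in at (0::real). a \<in> {-1<..}"
      by (intro eventually_at_topological[THEN iffD2]) (auto intro!: exI[of _ "{-1<..}"])
    then show ?thesis
    proof eventually_elim
      case (elim a)
      then have "0 < m * Beta (a + 1) m" using m by (intro mult_pos_pos Beta_real_pos) auto
      moreover have "exp (ln x / a) = x powr (1 / a)" if "0 < x" for x :: real
        using that by (simp add: powr_def)
      ultimately show ?case by blast
    qed
  qed
  ultimately have "((\<lambda>a. (m * Beta (a + 1) m) powr (1 / a)) \<longlongrightarrow> exp (model_log_derivative m)) (at 0)"
    by (rule Lim_transform_eventually)
  then show ?thesis by (simp add: norm_factor_def tendsto_Lim)
qed

lemma norm_factor_pos:
  assumes "0 < m" "-1 < a"
  shows "0 < norm_factor m a"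
proof (cases "a = 0")
  case False
  have "0 < m * Beta (a + 1) m" using assms by (intro mult_pos_pos Beta_real_pos) auto
  then have "0 < (m * Beta (a + 1) m) powr (1 / a)" using powr_gt_zero by (metis less_irrefl)
  with False show ?thesis by (simp only: norm_factor_def if_False)
qed (use assms norm_factor_0 in auto)

text \<open>For positive exponents the integral is a difference quotient at 0 of
  \<^term>\<open>\<lambda>a. L powr a * (m * Beta (a + 1) m) - Gamma (a + 1)\<close>.\<close>

lemma model_integral_zero:
  assumes m: "1 < m" and L: "0 < L"
  shows "(LINT t:{0<..}|lborel. t powr (0 - 1) * (model_profile m L t - exp (- t)))
    = ln L + model_log_derivative m + euler_mascheroni"
proof -
  define P where "P = (\<lambda>a::real. L powr a * (m * Beta (a + 1) m) - Gamma (a + 1))"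
  \<comment> \<open>Both moments have the form numerator over \<open>a\<close>, the second by
    \<open>Gamma a = Gamma (a + 1) / a\<close>. The numerators agree at 0, so \<open>P 0 = 0\<close>
    and the poles cancel.\<close>
  have eq: "(LINT t:{0<..}|lborel. t powr (a - 1) * (model_profile m L t - exp (- t))) = (P (0 + a) - P 0) / a"
    if a: "0 < a" for a
  proof -
    have "(LINT t:{0<..}|lborel. t powr (a - 1) * (model_profile m L t - exp (- t))) =
        (LINT t:{0<..}|lborel. t powr (a - 1) * model_profile m L t) - (LINT t:{0<..}|lborel. t powr (a - 1) * exp (- t))"
      unfolding right_diff_distrib
      using a decay_profile_model[OF m L]
      by (intro set_integral_diff(2) decay_profile_integrable_pos set_integrable_powr_exp) auto
    also have "(LINT t:{0<..}|lborel. t powr (a - 1) * exp (- t)) = Gamma a"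
      using set_integrable_powr_exp(2)[of "a - 1"] a by simp
    also have "\<dots> = Gamma (a + 1) / a" 
      using Gamma_plus1[OF pos_notin_nonpos_Ints[OF a]] a by simp
    also have "(LINT t:{0<..}|lborel. t powr (a - 1) * model_profile m L t) = L powr a * (m * Beta (a + 1) m) / a"
      using model_moment_pos[of m a L] m a L by (simp add: field_simps)
    finally show ?thesis
      using model_moment_derivative(1)[of m] m L by (simp add: P_def diff_divide_distrib)
  qed
  have "(Gamma has_real_derivative Gamma (0 + 1) * Digamma (0 + 1)) (at (0 + 1))"
    by (intro has_field_derivative_Gamma pos_notin_nonpos_Ints) simp
  then have G: "((\<lambda>a. Gamma (a + 1)) has_real_derivative - euler_mascheroni) (at 0)"
    by (simp only: DERIV_shift) simp
  have "((\<lambda>a. L powr a) has_real_derivative ln L) (at 0)"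
    using L by (auto intro!: derivative_eq_intros)
  from DERIV_diff[OF DERIV_mult[OF this model_moment_derivative(2)[of m]] G]
  have "(P has_real_derivative (ln L + model_log_derivative m + euler_mascheroni)) (at 0)"
    using m L model_moment_derivative(1)[of m] by (simp add: P_def mult.commute)
  then have "((\<lambda>a. (P (0 + a) - P 0) / a) \<longlongrightarrow> ln L + model_log_derivative m + euler_mascheroni) (at 0)"
    by (simp only: DERIV_def)
  moreover have "filterlim (\<lambda>n. inverse (real (Suc n))) (at 0) sequentially"
    using LIMSEQ_inverse_real_of_nat by (auto simp: filterlim_at)
  ultimately have "(\<lambda>n. (P (0 + inverse (real (Suc n))) - P 0) / inverse (real (Suc n))) \<longlonglongrightarrow> ln L + model_log_derivative m + euler_mascheroni"
    by (rule filterlim_compose)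
  moreover have "(\<lambda>n. (P (0 + inverse (real (Suc n))) - P 0) / inverse (real (Suc n))) =
      (\<lambda>n. LINT t:{0<..}|lborel. t powr (inverse (Suc n) - 1) * (model_profile m L t - exp (- t)))"
    by (intro ext eq[symmetric]) simp
  ultimately show ?thesis
    using LIMSEQ_unique[OF decay_profile_exp_tendsto[OF decay_profile_model[OF m L]]] by simp
qed

lemma moment_radius_model:
  assumes m: "1 < m" and L: "0 < L" and a: "-1 < a"
  shows "moment_radius (model_profile m L) a = L * norm_factor m a"
proof (cases "a = 0")
  case True
  have "moment_radius (model_profile m L) a = exp (ln L + model_log_derivative m)"
    using True model_integral_zero[OF m L] by (simp add: moment_radius_def)
  with True m L show ?thesis by (simp add: exp_add norm_factor_0)
next
  case False
  have "0 < m * Beta (a + 1) m" using m a by (intro mult_pos_pos Beta_real_pos) auto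
  moreover have "(L powr a) powr (1 / a) = L" using False L by (simp add: powr_powr)
  moreover have "moment_radius (model_profile m L) a = (L powr a * (m * Beta (a + 1) m)) powr (1 / a)"
    using False model_moment_pos[of m a L] model_moment_neg[of m a L] m a L
    by (cases "0 < a") (auto simp: moment_radius_def)
  ultimately show ?thesis using False L by (simp add: norm_factor_def powr_mult)
qed

section \<open>Comparison through a single change of sign\<close>

theorem moment_radius_comparison:
  fixes g :: "real \<Rightarrow> real"
  assumes m: "1 < m" and g: "decay_profile g"
    and conc: "\<And>t t'. 0 < t \<Longrightarrow> t < t' \<Longrightarrow> 0 < g t' \<Longrightarrow>
        (1 - t / t') + t / t' * g t' powr (1 / m) \<le> g t powr (1 / m)"
    and ab: "-1 < a" "a < b"
  shows "moment_radius g b / norm_factor m b \<le> moment_radius g a / norm_factor m a"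
proof -
  define L where "L = moment_radius g a / norm_factor m a"
  have pos: "0 < norm_factor m a" "0 < norm_factor m b" using norm_factor_pos m ab by auto
  have L: "0 < L" unfolding L_def using pos moment_radius_pos[OF g ab(1)] by simp
  define h where "h = model_profile m L"
  have h: "decay_profile h" unfolding h_def using decay_profile_model[OF m L] .
  have "moment_radius h a = moment_radius g a"
    unfolding h_def moment_radius_model[OF m L ab(1)] using pos by (simp add: L_def)
  define D where "D = (\<lambda>c. LINT t:{0<..}|lborel. t powr (c - 1) * (g t - h t))"
  \<comment> \<open>Equal radii, read as inequalities in both directions through
    \<open>moment_radius_le_iff\<close>, make the integral \<open>D a\<close> vanish.\<close>
  have "D a \<le> 0"
    unfolding D_def using moment_radius_le_iff[OF g h ab(1)] \<open>moment_radius h a = moment_radius g a\<close> by simp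
  moreover have "(LINT t:{0<..}|lborel. t powr (a - 1) * (h t - g t)) = - D a"
  proof -
    have "D a = (LINT t:{0<..}|lborel. - (t powr (a - 1) * (h t - g t)))"
      unfolding D_def by (simp add: algebra_simps)
    then show ?thesis by (simp add: set_lebesgue_integral_def)
  qed
  then have "- D a \<le> 0"
    using moment_radius_le_iff[OF h g ab(1)] \<open>moment_radius h a = moment_radius g a\<close> by simp
  ultimately have Da: "D a = 0" by simp
  \<comment> \<open>the \<open>m\<close>-th root of \<open>h\<close> is affine and agrees with that of \<open>g\<close> at 0, so \<open>g\<close> cannot return above \<open>h\<close>\<close>
  have cross: "g t' - h t' \<le> 0" if t: "0 < t" "t < t'" "g t < h t" for t t'
  proof (cases "0 < g t'")
    case False
    then show ?thesis using decay_profileD(2)[OF h, of t'] t by simp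
  next
    case True
    have g0: "0 \<le> g t" using decay_profileD(2)[OF g] t by auto
    have tL: "t < L"
    proof (rule ccontr)
      assume "\<not> t < L"
      then have "h t = 0" using L by (simp add: h_def model_profile_def max_def)
      with t g0 show False by simp
    qed
    have "g t powr (1 / m) < h t powr (1 / m)"
      using t g0 m by (intro powr_less_mono2) auto
    also have "\<dots> = 1 - t / L"
      using tL L m by (simp add: h_def model_profile_def max_def powr_powr)
    finally have "(1 - t / t') + t / t' * g t' powr (1 / m) < 1 - t / L"
      using conc[OF t(1,2) True] by linarith
    then have "t / t' * g t' powr (1 / m) < t / t' * (1 - t' / L)"
      using t by (simp add: algebra_simps)
    then have lt: "g t' powr (1 / m) < 1 - t' / L"
      by (rule mult_left_less_imp_less) (use t in simp)
    have "g t' = (g t' powr (1 / m)) powr m" using True m by (simp add: powr_powr)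
    also have "\<dots> \<le> h t'"
      unfolding h_def model_profile_def using lt m by (intro powr_mono2) auto
    finally show ?thesis by simp
  qed
  obtain T where T: "1 \<le> T" "\<And>t. T < t \<Longrightarrow> g t = 0" using decay_profile_bounds[OF g] by metis
  obtain S where S: "1 \<le> S" "\<And>t. S < t \<Longrightarrow> h t = 0" using decay_profile_bounds[OF h] by metis
  \<comment> \<open>The infimum of \<open>B\<close> is the crossing point. The element
    \<open>max T S\<close> keeps \<open>B\<close> nonempty if \<open>g\<close> never falls below
    \<open>h\<close>; both functions vanish beyond it, so \<open>g t \<le> h t\<close> holds to the
    right of every element of \<open>B\<close>.\<close>
  define B where "B = insert (max T S) {t. 0 < t \<and> g t < h t}"
  define r where "r = Inf B"
  have B: "bdd_below B" "B \<noteq> {}" unfolding B_def using T by (auto intro!: bdd_belowI[of _ 0])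
  have r0: "0 \<le> r" unfolding r_def using B T by (intro cInf_greatest) (auto simp: B_def)
  have before: "h t \<le> g t" if "0 < t" "t < r" for t
    using cInf_lower[OF _ B(1), of t] that by (force simp: B_def r_def)
  have after: "g t \<le> h t" if "r < t" for t
  proof -
    obtain u where u: "u \<in> B" "u < t" using cInf_lessD[OF B(2), of t] \<open>r < t\<close> r_def by auto
    show ?thesis
    proof (cases "u = max T S")
      case True
      then show ?thesis using T(2) S(2) u by auto
    next
      case False
      then show ?thesis using u cross[of u t] by (auto simp: B_def)
    qed
  qed
  \<comment> \<open>As \<open>b > a\<close>, the first factor goes from minus to plus at
    \<open>r\<close>, against \<open>g - h\<close>.\<close>
  have sign: "(t powr (b - a) - r powr (b - a)) * (g t - h t) \<le> 0" if t: "0 < t" for t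
  proof -
    consider "t < r" | "t = r" | "r < t" by linarith
    then show ?thesis
    proof cases
      case 1
      then show ?thesis using before[OF t] powr_mono2[of "b - a" t r] t ab
        by (intro mult_nonpos_nonneg) auto
    next
      case 3
      then show ?thesis using after powr_mono2[of "b - a" r t] r0 ab
        by (intro mult_nonneg_nonpos) auto
    qed simp
  qed
  have ib: "set_integrable lborel {0<..} (\<lambda>t. t powr (b - 1) * (g t - h t))"
    and ia: "set_integrable lborel {0<..} (\<lambda>t. r powr (b - a) * (t powr (a - 1) * (g t - h t)))"
    using decay_profile_integrable_diff[OF g h] ab by (auto intro!: set_integrable_mult_right)
  \<comment> \<open>Subtracting a multiple of the vanishing \<open>D a\<close> replaces the weight
    by one that changes sign exactly where \<open>g - h\<close> may, so the integrand becomes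
    nonpositive throughout.\<close>
  have "D b = D b - r powr (b - a) * D a" using Da by simp
  also have "\<dots> = (LINT t:{0<..}|lborel. t powr (b - 1) * (g t - h t) - r powr (b - a) * (t powr (a - 1) * (g t - h t)))"
    using set_integral_diff(2)[OF ib ia] by (simp add: D_def)
  also have "\<dots> \<le> (LINT t:{0::real<..}|lborel. (0::real))"
  proof (rule set_integral_mono)
    show "set_integrable lborel {0<..} (\<lambda>t. t powr (b - 1) * (g t - h t) - r powr (b - a) * (t powr (a - 1) * (g t - h t)))"
      using set_integral_diff(1)[OF ib ia] .
    fix t :: real assume "t \<in> {0<..}"
    then have t: "0 < t" by simp
    have "t powr (b - 1) * (g t - h t) - r powr (b - a) * (t powr (a - 1) * (g t - h t))
        = t powr (a - 1) * ((t powr (b - a) - r powr (b - a)) * (g t - h t))"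
      by (simp add: algebra_simps powr_add[symmetric])
    also have "\<dots> \<le> 0" by (rule mult_nonneg_nonpos[OF _ sign[OF t]]) simp
    finally show "t powr (b - 1) * (g t - h t) - r powr (b - a) * (t powr (a - 1) * (g t - h t)) \<le> 0" .
  qed (simp add: set_integrable_def)
  finally have "D b \<le> 0" by (simp add: set_lebesgue_integral_def)
  then have "moment_radius g b \<le> moment_radius h b"
    unfolding D_def using moment_radius_le_iff[OF g h, of b] ab by simp
  also have "\<dots> = L * norm_factor m b" unfolding h_def using moment_radius_model[OF m L] ab by simp
  finally show ?thesis using pos by (simp add: L_def[symmetric] field_simps)
qed

section \<open>The covariogram of an s-concave function\<close>

lemma weighted_Cauchy_Schwarz:
  fixes p l a b c d :: real
  assumes "0 \<le> p" "0 \<le> l"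
  shows "(p * (a * b) + l * (c * d))\<^sup>2 \<le> (p * a\<^sup>2 + l * c\<^sup>2) * (p * b\<^sup>2 + l * d\<^sup>2)"
proof -
  have "(p * a\<^sup>2 + l * c\<^sup>2) * (p * b\<^sup>2 + l * d\<^sup>2) - (p * (a * b) + l * (c * d))\<^sup>2 = p * l * (a * d - b * c)\<^sup>2"
    by (simp add: power2_eq_square algebra_simps)
  moreover have "0 \<le> p * l * (a * d - b * c)\<^sup>2" using assms by simp
  ultimately show ?thesis by linarith
qed

text \<open>For the powers \<open>f x powr (s / 2)\<close>, Cauchy-Schwarz bounds the squared mean
  of the products by the product of two means of \<open>f x powr s\<close>, and concavity bounds
  each of these. Taking the power \<open>1 / s\<close> of the square leaves the parameter
  \<open>2 / s\<close>.\<close>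

lemma power_mean_product_s_concave:
  fixes f :: "'a::euclidean_space \<Rightarrow> real"
  assumes s: "0 < s" and conc: "concave_on {x. 0 < f x} (\<lambda>x. f x powr s)"
    and l: "0 < l" "l < 1"
    and pos: "0 < f x" "0 < f x'" "0 < f y" "0 < f y'"
  shows "power_mean (2 / s) l (f x * f x') (f y * f y')
      \<le> f ((1 - l) *\<^sub>R x + l *\<^sub>R y) * f ((1 - l) *\<^sub>R x' + l *\<^sub>R y')"
proof -
  let ?z = "(1 - l) *\<^sub>R x + l *\<^sub>R y" and ?z' = "(1 - l) *\<^sub>R x' + l *\<^sub>R y'"
  have c: "(1 - l) * f u powr s + l * f v powr s \<le> f ((1 - l) *\<^sub>R u + l *\<^sub>R v) powr s"
    if "0 < f u" "0 < f v" for u v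
    using concave_onD[OF conc, of l u v] l that by auto
  have cz: "0 < f ((1 - l) *\<^sub>R u + l *\<^sub>R v)" if "0 < f u" "0 < f v" for u v
    using concave_on_imp_convex[OF conc] that l by (auto simp: convex_alt)
  have sq: "(u powr (s / 2))\<^sup>2 = u powr s" for u :: real
    by (simp add: power2_eq_square powr_add[symmetric])
  let ?r = "\<lambda>x. f x powr (s / 2)"
  define W where "W = (1 - l) * (?r x * ?r x') + l * (?r y * ?r y')"
  have W: "0 \<le> W" unfolding W_def using l by (intro add_nonneg_nonneg mult_nonneg_nonneg) auto
  have "W\<^sup>2 \<le> ((1 - l) * (?r x)\<^sup>2 + l * (?r y)\<^sup>2) * ((1 - l) * (?r x')\<^sup>2 + l * (?r y')\<^sup>2)"
    unfolding W_def using l by (intro weighted_Cauchy_Schwarz) auto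
  also have "\<dots> = ((1 - l) * f x powr s + l * f y powr s) * ((1 - l) * f x' powr s + l * f y' powr s)"
    by (simp only: sq)
  also have "\<dots> \<le> f ?z powr s * f ?z' powr s"
    by (rule mult_mono[OF c[OF pos(1,3)] c[OF pos(2,4)]])
       (use l in \<open>simp_all add: add_nonneg_nonneg mult_nonneg_nonneg\<close>)
  also have "\<dots> = (f ?z * f ?z') powr s"
    by (simp add: powr_mult)
  finally have "(W\<^sup>2) powr (1 / s) \<le> ((f ?z * f ?z') powr s) powr (1 / s)"
    using s by (intro powr_mono2) auto
  also have "\<dots> = f ?z * f ?z'"
    using s cz[of x y] cz[of x' y'] pos by (simp add: powr_powr)
  also have "(W\<^sup>2) powr (1 / s) = W powr (2 / s)"
    using W powr_powr[of W 2 "1 / s"] by simp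
  also have "\<dots> = power_mean (2 / s) l (f x * f x') (f y * f y')"
    unfolding power_mean_def W_def by (simp add: powr_mult)
  finally show ?thesis .
qed

lemma lborel_translate:
  fixes h :: "'a::euclidean_space \<Rightarrow> real"
  assumes [measurable]: "h \<in> borel_measurable borel"
  shows "integrable lborel (\<lambda>x. h (x + v)) \<longleftrightarrow> integrable lborel h" "(\<integral>x. h (x + v) \<partial>lborel) = (\<integral>x. h x \<partial>lborel)"
proof -
  have "integrable lborel h \<longleftrightarrow> integrable (distr lborel borel ((+) v)) h"
    by (simp add: lborel_distr_plus)
  also have "\<dots> \<longleftrightarrow> integrable lborel (\<lambda>x. h (v + x))" by (rule integrable_distr_eq) auto
  finally show "integrable lborel (\<lambda>x. h (x + v)) \<longleftrightarrow> integrable lborel h" by (simp add: add.commute)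
  have "(\<integral>x. h x \<partial>lborel) = (\<integral>x. h x \<partial>distr lborel borel ((+) v))"
    by (simp add: lborel_distr_plus)
  also have "\<dots> = (\<integral>x. h (v + x) \<partial>lborel)" by (rule integral_distr) auto
  finally show "(\<integral>x. h (x + v) \<partial>lborel) = (\<integral>x. h x \<partial>lborel)" by (simp add: add.commute)
qed

text \<open>The situation for one fixed direction, after passing to a Borel representative with open
  support.\<close>

locale s_concave_L2 =
  fixes f :: "'a::euclidean_space \<Rightarrow> real" and s :: real and \<xi> :: 'a
  assumes s: "0 < s" and meas[measurable]: "f \<in> borel_measurable borel" and nonneg: "\<And>x. 0 \<le> f x"
    and int: "integrable lborel (\<lambda>x. (f x)\<^sup>2)"
    and open_supp: "open {x. 0 < f x}" and conc: "concave_on {x. 0 < f x} (\<lambda>x. f x powr s)"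
    and norm_pos: "0 < (\<integral>x. (f x)\<^sup>2 \<partial>lborel)" and unit: "norm \<xi> = 1"
begin

abbreviation "nsq \<equiv> (\<integral>x. (f x)\<^sup>2 \<partial>lborel)"

definition "cov t = (\<integral>x. f x * f (x + t *\<^sub>R \<xi>) \<partial>lborel)"

lemma shift_square: "integrable lborel (\<lambda>x. (f (x + v))\<^sup>2)" "(\<integral>x. (f (x + v))\<^sup>2 \<partial>lborel) = nsq"
  using lborel_translate[of "\<lambda>x. (f x)\<^sup>2" v] int by auto

lemma integrable_product: "integrable lborel (\<lambda>x. f x * f (x + v))"
proof (rule Bochner_Integration.integrable_bound)
  show "integrable lborel (\<lambda>x. (f x)\<^sup>2 + (f (x + v))\<^sup>2)"
    using int shift_square by (intro Bochner_Integration.integrable_add)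
  have "f x * f (x + v) \<le> (f x)\<^sup>2 + (f (x + v))\<^sup>2" for x
    using nonneg[of x] nonneg[of "x + v"] sum_squares_bound[of "f x" "f (x + v)"] mult_nonneg_nonneg[of "f x" "f (x + v)"] by linarith
  then show "AE x in lborel. norm (f x * f (x + v)) \<le> norm ((f x)\<^sup>2 + (f (x + v))\<^sup>2)"
    using nonneg by (intro AE_I2) (simp add: abs_mult)
qed measurable

lemma cov_nonneg: "0 \<le> cov t"
  unfolding cov_def using nonneg by (intro integral_nonneg_AE) auto

lemma cov_0: "cov 0 = nsq"
  by (simp add: cov_def power2_eq_square)

text \<open>Expanding the square and using translation invariance expresses the integrand for
  negative indices through the covariogram. Its nonnegativity also yields
  \<open>cov_le\<close>.\<close>

lemma integral_square_diff:
  "(\<integral>x. \<bar>f (x + t *\<^sub>R \<xi>) - f x\<bar>\<^sup>2 \<partial>lborel) = 2 * nsq - 2 * cov t"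
proof -
  have "(\<integral>x. \<bar>f (x + t *\<^sub>R \<xi>) - f x\<bar>\<^sup>2 \<partial>lborel) =
      (\<integral>x. ((f (x + t *\<^sub>R \<xi>))\<^sup>2 + (f x)\<^sup>2) - 2 * (f x * f (x + t *\<^sub>R \<xi>)) \<partial>lborel)"
    by (intro Bochner_Integration.integral_cong) (auto simp: power2_eq_square algebra_simps)
  also have "\<dots> = 2 * nsq - 2 * cov t"
    using int shift_square integrable_product by (simp add: cov_def)
  finally show ?thesis .
qed

lemma cov_le: "cov t \<le> nsq"
proof -
  have "0 \<le> (\<integral>x. \<bar>f (x + t *\<^sub>R \<xi>) - f x\<bar>\<^sup>2 \<partial>lborel)"
    by (intro integral_nonneg_AE) auto
  then show ?thesis unfolding integral_square_diff by simp
qed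

lemma measurable_cov: "cov \<in> borel_measurable borel"
  unfolding cov_def[abs_def] by measurable

text \<open>A small shift keeps a point of the open support inside it, so the product is positive on
  a nonempty open set. The positive value anchors the chord that bounds \<open>profile\<close> from
  below near 0.\<close>

lemma cov_pos_somewhere: "\<exists>t>0. 0 < cov t"
proof -
  have "\<exists>x. 0 < f x"
  proof (rule ccontr)
    assume "\<nexists>x. 0 < f x"
    then have "f x = 0" for x using nonneg[of x] by (metis less_eq_real_def)
    with norm_pos show False by simp
  qed
  then obtain x where x: "x \<in> {x. 0 < f x}" by auto
  then obtain e where e: "0 < e" "ball x e \<subseteq> {x. 0 < f x}"
    using open_supp by (meson open_contains_ball)
  define t where "t = e / 2"
  have t: "0 < t" using e by (simp add: t_def)
  let ?U = "{y. 0 < f y} \<inter> (\<lambda>y. y + t *\<^sub>R \<xi>) -` {y. 0 < f y}"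
  have "open ?U"
    using open_supp by (intro open_Int open_vimage) (auto intro!: continuous_intros)
  moreover have "x + t *\<^sub>R \<xi> \<in> ball x e"
    using e unit by (simp add: dist_norm t_def)
  then have "x \<in> ?U" using x e by auto
  ultimately have "\<not> negligible ?U" using open_not_negligible by blast
  have "cov t \<noteq> 0"
  proof
    assume "cov t = 0"
    then have "AE x in lborel. f x * f (x + t *\<^sub>R \<xi>) = 0"
      unfolding cov_def using integrable_product nonneg
      by (subst (asm) integral_nonneg_eq_0_iff_AE) auto
    then have "AE x in lborel. x \<notin> ?U" by eventually_elim auto
    then have "?U \<in> null_sets lborel"
      using \<open>open ?U\<close> by (intro iffD2[OF AE_iff_null_sets]) auto
    then show False using \<open>\<not> negligible ?U\<close> \<open>open ?U\<close>
      by (simp add: negligible_iff_null_sets null_sets_completionI)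
  qed
  with cov_nonneg[of t] t show ?thesis by force
qed

text \<open>For large \<open>t\<close> one of \<open>x\<close> and \<open>x + t \<xi>\<close> lies far from the origin, where \<open>f\<close> carries little mass.\<close>

lemma cov_less_somewhere: "\<exists>t>0. cov t < nsq"
proof -
  define w where "w = (\<lambda>(n::nat) x. indicator {x. real n \<le> norm x} x * (f x)\<^sup>2)"
  have w_meas[measurable]: "w n \<in> borel_measurable borel" for n unfolding w_def by measurable
  have w0: "0 \<le> w n x" for n x by (simp add: w_def)
  have w_int: "integrable lborel (w n)" for n
    by (rule Bochner_Integration.integrable_bound[OF int]) (auto simp: w_def indicator_def)
  have "(\<lambda>n. \<integral>x. w n x \<partial>lborel) \<longlonglongrightarrow> (\<integral>x. 0 \<partial>(lborel :: 'a measure))"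
  proof (rule integral_dominated_convergence[OF _ _ int])
    show "AE x in lborel. (\<lambda>n. w n x) \<longlonglongrightarrow> 0"
    proof (intro AE_I2 tendsto_eventually)
      fix x :: 'a
      obtain N :: nat where "norm x < real N" using reals_Archimedean2 by blast
      then show "\<forall>\<^sub>F n in sequentially. w n x = 0"
        by (intro eventually_sequentiallyI[of N]) (auto simp: w_def indicator_def)
    qed
    show "AE x in lborel. norm (w n x) \<le> (f x)\<^sup>2" for n by (auto simp: w_def indicator_def)
  qed auto
  then have "\<forall>\<^sub>F n in sequentially. (\<integral>x. w n x \<partial>lborel) < nsq / 4"
    using norm_pos by (intro order_tendstoD) auto
  then obtain n0 where n0: "\<And>n. n \<ge> n0 \<Longrightarrow> (\<integral>x. w n x \<partial>lborel) < nsq / 4"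
    by (auto simp: eventually_sequentially)
  define n where "n = Suc n0"
  define v where "v = (2 * real n) *\<^sub>R \<xi>"
  \<comment> \<open>The inequality between products and squares is used asymmetrically: weight 1 at
    the far point, where \<open>w n\<close> equals the square, and weight 1/4 at the other.
    Integration gives \<open>nsq / 2\<close> plus twice the integral of \<open>w n\<close>, which
    explains the threshold \<open>nsq / 4\<close>.\<close>
  have le: "f x * f (x + v) \<le> ((f x)\<^sup>2 + (f (x + v))\<^sup>2) / 4 + (w n x + w n (x + v))" for x
  proof -
    have ag: "u * u' \<le> u\<^sup>2 + u'\<^sup>2 / 4" for u u' :: real
      using zero_le_power2[of "u - u' / 2"] by (simp add: power2_eq_square algebra_simps)
    have "norm v = 2 * real n" using unit by (simp add: v_def)
    then have "2 * real n \<le> norm (x + v) + norm x"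
      using norm_triangle_ineq4[of "x + v" x] by simp
    then consider "real n \<le> norm x" | "real n \<le> norm (x + v)" by linarith
    then show ?thesis
    proof cases
      case 1
      then have "w n x = (f x)\<^sup>2" by (simp add: w_def)
      with ag[of "f x" "f (x + v)"] w0[of n "x + v"] zero_le_power2[of "f x"] show ?thesis
        by argo
    next
      case 2
      then have "w n (x + v) = (f (x + v))\<^sup>2" by (simp add: w_def)
      with ag[of "f (x + v)" "f x", unfolded mult.commute[of "f (x + v)" "f x"]] w0[of n x] zero_le_power2[of "f (x + v)"] show ?thesis
        by argo
    qed
  qed
  have wv: "integrable lborel (\<lambda>x. w n (x + v))" "(\<integral>x. w n (x + v) \<partial>lborel) = (\<integral>x. w n x \<partial>lborel)"
    using lborel_translate[of "w n" v] w_int by auto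
  have "cov (2 * real n) \<le> (\<integral>x. ((f x)\<^sup>2 + (f (x + v))\<^sup>2) / 4 + (w n x + w n (x + v)) \<partial>lborel)"
    unfolding cov_def v_def[symmetric]
    using le int shift_square w_int wv integrable_product by (intro integral_mono) auto
  also have "\<dots> = nsq / 2 + 2 * (\<integral>x. w n x \<partial>lborel)"
    using int shift_square w_int wv by simp
  also have "\<dots> < nsq" using n0[of n] by (simp add: n_def)
  finally show ?thesis by (intro exI[of _ "2 * real n"]) (simp add: n_def)
qed

lemma cov_concave:
  assumes l: "0 < l" "l < 1" and t: "0 < cov t"
  shows "power_mean (2 / s + DIM('a)) l nsq (cov t) \<le> cov (l * t)"
\<comment> \<open>\<open>Borell_Brascamp_Lieb\<close> takes numbers strictly below the integrals, so
  both are shrunk by \<open>r < 1\<close>. Homogeneity pulls \<open>r\<close> out of the mean, and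
  \<open>r\<close> tends to 1.\<close>
proof (rule field_le_mult_one_interval)
  fix r :: real assume r: "0 < r" "r < 1"
  have nn: "(\<integral>\<^sup>+x. ennreal (f x * f (x + u *\<^sub>R \<xi>)) \<partial>lborel) = ennreal (cov u)" for u
    unfolding cov_def using integrable_product nonneg by (intro nn_integral_eq_integral) auto
  have "ennreal (power_mean (2 / s + DIM('a)) l (r * nsq) (r * cov t)) \<le> (\<integral>\<^sup>+x. ennreal (f x * f (x + (l * t) *\<^sub>R \<xi>)) \<partial>lborel)"
  proof (rule Borell_Brascamp_Lieb[where ?h0.0 = "\<lambda>x. ennreal (f x * f (x + 0 *\<^sub>R \<xi>))"
        and ?h1.0 = "\<lambda>x. ennreal (f x * f (x + t *\<^sub>R \<xi>))"])
    show "ennreal (r * nsq) < (\<integral>\<^sup>+x. ennreal (f x * f (x + 0 *\<^sub>R \<xi>)) \<partial>lborel)"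
      unfolding nn cov_0 using r norm_pos by (intro ennreal_lessI) auto
    show "ennreal (r * cov t) < (\<integral>\<^sup>+x. ennreal (f x * f (x + t *\<^sub>R \<xi>)) \<partial>lborel)"
      unfolding nn using r t by (intro ennreal_lessI) auto
    fix x y and a b :: real
    assume a: "0 < a" and b: "0 < b" and h: "ennreal a < ennreal (f x * f (x + 0 *\<^sub>R \<xi>))" "ennreal b < ennreal (f y * f (y + t *\<^sub>R \<xi>))"
    have ab: "a < f x * f x" "b < f y * f (y + t *\<^sub>R \<xi>)"
      using h a b by (auto simp: ennreal_less_iff)
    then have "0 < f x * f x" "0 < f y * f (y + t *\<^sub>R \<xi>)" using a b by linarith+
    then have p: "0 < f x" "0 < f y" "0 < f (y + t *\<^sub>R \<xi>)"
      using nonneg[of x] nonneg[of y] nonneg[of "y + t *\<^sub>R \<xi>"]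
      by (auto simp: zero_less_mult_iff)
    have "power_mean (2 / s) l a b \<le> power_mean (2 / s) l (f x * f x) (f y * f (y + t *\<^sub>R \<xi>))"
      using ab a b l s by (intro power_mean_mono) auto
    also have "\<dots> \<le> f ((1 - l) *\<^sub>R x + l *\<^sub>R y) * f ((1 - l) *\<^sub>R x + l *\<^sub>R (y + t *\<^sub>R \<xi>))"
      using p by (intro power_mean_product_s_concave[OF s conc l]) auto
    finally show "ennreal (power_mean (2 / s) l a b)
        \<le> ennreal (f ((1 - l) *\<^sub>R x + l *\<^sub>R y) * f ((1 - l) *\<^sub>R x + l *\<^sub>R y + (l * t) *\<^sub>R \<xi>))"
      by (intro ennreal_leI) (simp add: algebra_simps)
  qed (use s l r t norm_pos in auto)
  then have "power_mean (2 / s + DIM('a)) l (r * nsq) (r * cov t) \<le> cov (l * t)"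
    unfolding nn using cov_nonneg by (simp add: ennreal_le_iff)
  then show "r * power_mean (2 / s + DIM('a)) l nsq (cov t) \<le> cov (l * t)"
    using s l r t norm_pos by (subst (asm) power_mean_scale) (auto simp: add_pos_nonneg)
qed

definition "profile t = cov t / nsq"

lemma exponent_gt_1: "1 < real DIM('a) + 2 / s"
proof -
  have "1 \<le> real DIM('a)" using DIM_positive[where 'a = 'a] by linarith
  moreover have "0 < 2 / s" using s by simp
  ultimately show ?thesis by linarith
qed

lemma profile_concave:
  assumes t: "0 < t" "t < t'" "0 < profile t'"
  shows "(1 - t / t') + t / t' * profile t' powr (1 / (real DIM('a) + 2 / s)) \<le> profile t powr (1 / (real DIM('a) + 2 / s))"
proof -
  define l where "l = t / t'"
  have l: "0 < l" "l < 1" using t by (auto simp: l_def)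
  have c: "0 < cov t'" using t norm_pos by (simp add: profile_def zero_less_divide_iff)
  have "power_mean (real DIM('a) + 2 / s) l (nsq * 1) (nsq * profile t') \<le> cov (l * t')"
    using cov_concave[OF l c] norm_pos by (simp add: profile_def add.commute)
  then have "nsq * power_mean (real DIM('a) + 2 / s) l 1 (profile t') \<le> cov t"
    using l t norm_pos exponent_gt_1 by (subst (asm) power_mean_scale) (auto simp: l_def)
  then have "power_mean (real DIM('a) + 2 / s) l 1 (profile t') \<le> profile t"
    using norm_pos by (simp add: profile_def pos_le_divide_eq mult.commute)
  then have "power_mean (real DIM('a) + 2 / s) l 1 (profile t') powr (1 / (real DIM('a) + 2 / s)) \<le> profile t powr (1 / (real DIM('a) + 2 / s))"
    using exponent_gt_1 power_mean_pos[OF l, of 1 "profile t'" "real DIM('a) + 2 / s"] t by (intro powr_mono2) auto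
  also have "power_mean (real DIM('a) + 2 / s) l 1 (profile t') powr (1 / (real DIM('a) + 2 / s)) = (1 - l) + l * profile t' powr (1 / (real DIM('a) + 2 / s))"
    using l exponent_gt_1 unfolding power_mean_def by (simp add: powr_powr)
  finally show ?thesis by (simp add: l_def)
qed

text \<open>Both bounds come from chords of the concave root that start with height 1 at 0. The
  chord to a point \<open>u\<close> of positive value lies above \<open>1 - t / u\<close>, and
  Bernoulli's inequality makes the bound linear. Conversely, a positive value at a far
  \<open>t\<close> forces the root at \<open>v\<close> to be at least \<open>1 - v / t\<close>; for
  large \<open>t\<close> this contradicts \<open>profile v < 1\<close>.\<close>

lemma decay_profile_profile: "decay_profile profile"
  unfolding decay_profile_def
proof (intro conjI allI impI)
  show "profile \<in> borel_measurable borel"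
    unfolding profile_def[abs_def] using measurable_cov by measurable
  show nn: "0 \<le> profile t" for t using cov_nonneg[of t] norm_pos by (simp add: profile_def)
  show le1: "profile t \<le> 1" for t using cov_le[of t] norm_pos by (simp add: profile_def)
  obtain u where u: "0 < u" "0 < profile u"
    using cov_pos_somewhere norm_pos by (auto simp: profile_def)
  have "1 - profile t \<le> (real DIM('a) + 2 / s) / u * t" if t: "0 < t" for t
  proof (cases "t < u")
    case True
    have "1 - (real DIM('a) + 2 / s) * (t / u) \<le> (1 - t / u) powr (real DIM('a) + 2 / s)"
      using True t u exponent_gt_1 by (intro one_minus_powr_ge) auto
    also have "\<dots> \<le> (profile t powr (1 / (real DIM('a) + 2 / s))) powr (real DIM('a) + 2 / s)"
    proof (intro powr_mono2)
      have "0 \<le> t / u * profile u powr (1 / (real DIM('a) + 2 / s))" using t u by simp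
      then show "1 - t / u \<le> profile t powr (1 / (real DIM('a) + 2 / s))"
        using profile_concave[OF t True u(2)] by linarith
    qed (use True t u exponent_gt_1 in auto)
    also have "\<dots> = profile t"
      using nn[of t] exponent_gt_1 by (simp add: powr_powr)
    finally show ?thesis by simp
  next
    case False
    then have "u * 1 \<le> t * (real DIM('a) + 2 / s)" using exponent_gt_1 u by (intro mult_mono) auto
    then have "1 \<le> (real DIM('a) + 2 / s) / u * t" using u by (simp add: field_simps)
    with nn[of t] show ?thesis by linarith
  qed
  then show "\<exists>C. \<forall>t>0. 1 - profile t \<le> C * t" by blast
  obtain v where v: "0 < v" "profile v < 1"
    using cov_less_somewhere norm_pos by (auto simp: profile_def)
  define p where "p = profile v powr (1 / (real DIM('a) + 2 / s))"
  have p: "p < 1" "0 \<le> p"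
    unfolding p_def using powr_less_mono2[of "1 / (real DIM('a) + 2 / s)" "profile v" 1] v nn[of v] exponent_gt_1 by auto
  have "profile t = 0" if t: "max v (v / (1 - p)) < t" for t
  proof (rule ccontr)
    assume "profile t \<noteq> 0"
    then have pt: "0 < profile t" using nn[of t] by simp
    have vt: "v < t" "0 < t" using t v by auto
    have "0 \<le> v / t * profile t powr (1 / (real DIM('a) + 2 / s))" using v vt by simp
    then have "1 - v / t \<le> p"
      using profile_concave[OF v(1) vt(1) pt] unfolding p_def by linarith
    then have "t * (1 - p) \<le> v" using vt by (simp add: field_simps)
    moreover have "v < t * (1 - p)" using t p by (simp add: field_simps)
    ultimately show False by simp
  qed
  then show "\<exists>T. \<forall>t>T. profile t = 0" by blast
qed

end

text \<open>A concave function is continuous in the interior of its domain, so setting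
  \<open>f\<close> to 0 outside the interior of the support gives a Borel function. Values can
  change only on the frontier, which is a null set because the support is convex.\<close>

lemma s_concave_borel_version:
  fixes f :: "'a::euclidean_space \<Rightarrow> real"
  assumes s: "0 < s" and sc: "s_concave s f"
  obtains g where "g \<in> borel_measurable borel" "\<And>x. 0 \<le> g x" "open {x. 0 < g x}"
    "concave_on {x. 0 < g x} (\<lambda>x. g x powr s)" "AE x in lebesgue. f x = g x"
proof -
  let ?C = "{x. 0 < f x}"
  let ?U = "interior ?C"
  define g where "g = (\<lambda>x. if x \<in> ?U then f x else 0)"
  have nn: "0 \<le> f x" for x using sc by (simp add: s_concave_def)
  have conc: "concave_on ?C (\<lambda>x. f x powr s)" using sc by (simp add: s_concave_def)
  then have conv: "convex ?C" by (rule concave_on_imp_convex)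
  have U: "?U \<subseteq> ?C" by (rule interior_subset)
  have supp: "{x. 0 < g x} = ?U" using U by (auto simp: g_def)
  have concU: "concave_on ?U (\<lambda>x. f x powr s)"
    using conc U convex_interior[OF conv] unfolding concave_on_def by (rule convex_on_subset)
  then have "continuous_on ?U (\<lambda>x. - (f x powr s))"
    unfolding concave_on_def by (intro convex_on_continuous) auto
  then have "continuous_on ?U (\<lambda>x. - (- (f x powr s)))" by (rule continuous_on_minus)
  then have c: "continuous_on ?U (\<lambda>x. f x powr s)" by simp
  have "continuous_on ?U (\<lambda>x. (f x powr s) powr (1 / s))"
    by (rule continuous_on_powr[OF c continuous_on_const]) (use U in auto)
  then have cont: "continuous_on ?U f"
    using s nn by (simp add: powr_powr)
  show thesis
  proof (rule that[of g])
    show "g \<in> borel_measurable borel"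
      unfolding g_def using cont by (intro borel_measurable_continuous_on_if) auto
    show "0 \<le> g x" for x using nn by (simp add: g_def)
    show "open {x. 0 < g x}" by (simp add: supp)
    show "concave_on {x. 0 < g x} (\<lambda>x. g x powr s)"
      unfolding supp using concU by (auto simp: concave_on_iff g_def convexD)
    have "frontier ?C \<in> null_sets lebesgue"
      using negligible_convex_frontier[OF conv] by (simp add: negligible_iff_null_sets)
    then have "AE x in lebesgue. x \<notin> frontier ?C" by (rule AE_not_in)
    then show "AE x in lebesgue. f x = g x"
    proof eventually_elim
      case (elim x)
      have "f x = 0" if "x \<notin> ?U"
      proof -
        have "x \<notin> ?C" using that elim closure_subset[of ?C] by (auto simp: frontier_def)
        with nn[of x] show ?thesis by simp
      qed
      then show ?case by (simp add: g_def)
    qed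
  qed
qed

lemma translation_lebesgue_measurable: "(\<lambda>x. x + v) \<in> lebesgue \<rightarrow>\<^sub>M (lebesgue :: 'a::euclidean_space measure)"
proof -
  have "(\<lambda>x::'a. v + (\<Sum>j\<in>Basis. (1 * (x \<bullet> j)) *\<^sub>R j)) \<in> lebesgue \<rightarrow>\<^sub>M lebesgue"
    by (rule lebesgue_affine_measurable) auto
  then show ?thesis by (simp add: euclidean_representation add.commute)
qed

lemma AE_lebesgue_translate:
  fixes v :: "'a::euclidean_space"
  assumes "AE x in lebesgue. P x"
  shows "AE x in lebesgue. P (x + v)"
proof -
  have "AE x in lborel. P x" using assms by (simp add: AE_completion_iff)
  then have "AE x in distr lborel borel ((+) v). P x" by (simp only: lborel_distr_plus)
  then have "AE x in lborel. P (v + x)" by (rule AE_distrD[rotated]) auto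
  then show ?thesis by (simp add: AE_completion_iff add.commute)
qed

theorem theorem21:
  fixes f :: "'a::euclidean_space \<Rightarrow> real" and s \<alpha> \<beta> :: real
  assumes "0 < s"
    and "f \<in> borel_measurable lebesgue"
    and "integrable lebesgue (\<lambda>x. (f x)\<^sup>2)"
    and "0 < L2_norm_sq f"
    and "s_concave s f"
    and "-1 < \<alpha>" and "\<alpha> < \<beta>"
  shows "\<forall>\<xi>\<in>sphere 0 1.
           (1 / norm_factor (real DIM('a) + 2 / s) \<beta>) * radial_mean f \<beta> \<xi>
             \<le> (1 / norm_factor (real DIM('a) + 2 / s) \<alpha>) * radial_mean f \<alpha> \<xi>"
proof
  fix \<xi> :: 'a assume "\<xi> \<in> sphere 0 1"
  then have unit: "norm \<xi> = 1" by simp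
  note f[measurable] = assms(2)
  obtain g where g[measurable]: "g \<in> borel_measurable borel" and g0: "\<And>x. 0 \<le> g x" "open {x. 0 < g x}"
    "concave_on {x. 0 < g x} (\<lambda>x. g x powr s)" and ae: "AE x in lebesgue. f x = g x"
    using s_concave_borel_version[OF assms(1,5)] by blast
  \<comment> \<open>Translations preserve null sets, so products of \<open>f\<close> with its shifts
    also agree almost everywhere with those of \<open>g\<close>; the integrals in all three formulas
    can be taken for \<open>g\<close>.\<close>
  have aet: "AE x in lebesgue. f (x + v) = g (x + v)" for v
    using AE_lebesgue_translate[OF ae] .
  have gl: "g \<in> borel_measurable lebesgue" by (intro measurable_completion) simp
  have fv: "(\<lambda>x. f (x + v)) \<in> borel_measurable lebesgue" "(\<lambda>x. g (x + v)) \<in> borel_measurable lebesgue" for v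
    using measurable_compose[OF translation_lebesgue_measurable f] measurable_compose[OF translation_lebesgue_measurable gl] by auto
  note [measurable] = gl fv
  have "integrable lebesgue (\<lambda>x. (g x)\<^sup>2)"
    using assms(3) by (rule integrable_cong_AE_imp) (use ae in auto)
  then have int: "integrable lborel (\<lambda>x. (g x)\<^sup>2)"
    by (subst (asm) integrable_completion) auto
  have "L2_norm_sq f = (\<integral>x. (g x)\<^sup>2 \<partial>lebesgue)"
    unfolding L2_norm_sq_def by (rule integral_cong_AE) (use ae in auto)
  also have "\<dots> = (\<integral>x. (g x)\<^sup>2 \<partial>lborel)" by (rule integral_completion) measurable
  finally have nsq: "L2_norm_sq f = (\<integral>x. (g x)\<^sup>2 \<partial>lborel)" .
  interpret s_concave_L2 g s \<xi>
    using assms(1,4) g0 int unit nsq by unfold_locales auto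
  have cov: "covar f \<xi> t = cov t" for t
  proof -
    have "covar f \<xi> t = (\<integral>x. g x * g (x + t *\<^sub>R \<xi>) \<partial>lebesgue)"
      unfolding covar_def
    proof (rule integral_cong_AE)
      show "AE x in lebesgue. f x * f (x + t *\<^sub>R \<xi>) = g x * g (x + t *\<^sub>R \<xi>)"
        using ae aet[of "t *\<^sub>R \<xi>"] by eventually_elim simp
    qed measurable
    also have "\<dots> = cov t" unfolding cov_def by (rule integral_completion) measurable
    finally show ?thesis .
  qed
  have diff: "(\<integral>x. \<bar>f (x + t *\<^sub>R \<xi>) - f x\<bar>\<^sup>2 \<partial>lebesgue) = 2 * nsq - 2 * cov t" for t
  proof -
    have "(\<integral>x. \<bar>f (x + t *\<^sub>R \<xi>) - f x\<bar>\<^sup>2 \<partial>lebesgue) = (\<integral>x. \<bar>g (x + t *\<^sub>R \<xi>) - g x\<bar>\<^sup>2 \<partial>lebesgue)"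
    proof (rule integral_cong_AE)
      show "AE x in lebesgue. \<bar>f (x + t *\<^sub>R \<xi>) - f x\<bar>\<^sup>2 = \<bar>g (x + t *\<^sub>R \<xi>) - g x\<bar>\<^sup>2"
        using ae aet[of "t *\<^sub>R \<xi>"] by eventually_elim simp
    qed measurable
    also have "\<dots> = (\<integral>x. \<bar>g (x + t *\<^sub>R \<xi>) - g x\<bar>\<^sup>2 \<partial>lborel)"
      by (rule integral_completion) measurable
    finally show ?thesis by (simp only: integral_square_diff)
  qed
  have radial: "radial_mean f a \<xi> = moment_radius profile a" for a
  proof -
    consider "0 < a" | "a < 0" | "a = 0" by linarith
    then show ?thesis
    proof cases
      case 1
      have "(LINT t:{0<..}|lborel. t powr (a - 1) * cov t) = (LINT t:{0<..}|lborel. nsq * (t powr (a - 1) * profile t))"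
        using norm_pos by (simp add: profile_def)
      with 1 show ?thesis
        using norm_pos by (simp add: radial_mean_def moment_radius_def cov nsq)
    next
      case 2
      have "2 * nsq - 2 * cov t = (2 * nsq) * (1 - profile t)" for t
        using norm_pos by (simp add: profile_def algebra_simps)
      then have "(LINT t:{0<..}|lborel. t powr (a - 1) * (2 * nsq - 2 * cov t)) = (LINT t:{0<..}|lborel. (2 * nsq) * (t powr (a - 1) * (1 - profile t)))"
        by (simp add: mult.left_commute)
      with 2 show ?thesis
        using norm_pos unfolding radial_mean_def moment_radius_def diff nsq by simp
    next
      case 3
      have "(LINT t:{0<..}|lborel. (1 / t) * (profile t - exp (- t))) = (LINT t:{0<..}|lborel. t powr (a - 1) * (profile t - exp (- t)))"
        using 3 by (intro set_lebesgue_integral_cong) (auto simp: powr_minus_divide)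
      with 3 show ?thesis
        by (simp add: radial_mean_def moment_radius_def cov nsq profile_def)
    qed
  qed
  have "moment_radius profile \<beta> / norm_factor (real DIM('a) + 2 / s) \<beta> \<le> moment_radius profile \<alpha> / norm_factor (real DIM('a) + 2 / s) \<alpha>"
    by (rule moment_radius_comparison[OF exponent_gt_1 decay_profile_profile profile_concave assms(6,7)])
  then show "(1 / norm_factor (real DIM('a) + 2 / s) \<beta>) * radial_mean f \<beta> \<xi>
             \<le> (1 / norm_factor (real DIM('a) + 2 / s) \<alpha>) * radial_mean f \<alpha> \<xi>"
    by (simp add: radial)
qed

end
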